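(* Let $n\ge4$ be even and let $F$ be any field. Let $L$ be the $(n+1)$-dimensional $n$-Lie algebra over $F$ with basis $e_1,\dots,e_{n+1}$ and structure constants $[e_1,\dots,e_n]=e_1$ (brackets of basis elements not determined by this one and the alternating property are zero). In $F\langle X\rangle$, $X=\{x_1,\dots,x_{n+1}\}$, let $$G_i=(-1)^{\lfloor n/2\rfloor}\mathrm{alt}(x_1,\dots,\widehat{x}_i,\dots,x_{n+1})\ (1\le i\le n),\qquad G_{n+1}=(-1)^{\lfloor n/2\rfloor}\big(\mathrm{alt}(x_1,\dots,x_n)-x_1\big),$$ let $N=x_{n+1}x_1-x_1x_{n+1}$, and for $2\le i\le n$ let $$H_i=(-1)^{\lfloor n/2\rfloor}\sum_{\sigma\in T_n^{(i)}}\epsilon(\sigma)\,x_{\sigma(1)}x_{\sigma(2)}\cdots x_{\sigma(n)},$$ where $T_n^{(i)}$ is the set of all permutations of $\{1,\dots,\widehat{i},\dots,n+1\}$ in which $1$ and $n+1$ do not appear consecutively. Then $$\{G_1,H_2,\dots,H_n,G_{n+1},N\}$$ is a Gröbner basis (with respect to the degree-lexicographical order) of the ideal $I=\langle G_1,\dots,G_{n+1}\rangle\subseteq F\langle X\rangle$.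
   Context: An $n$-Lie algebra is a vector space with a multilinear alternating operation $[z_1,\dots,z_n]$ satisfying $[[z_1,\dots,z_n],w_2,\dots,w_n]=\sum_{i=1}^n[z_1,\dots,[z_i,w_2,\dots,w_n],\dots,z_n]$. The elements $G_i$ are the generators of the ideal defining the universal associative envelope $U(L)=F\langle X\rangle/I$. A hat means the entry is omitted. $\mathrm{alt}(z_1,\dots,z_n)=\sum_{\sigma\in S_n}\epsilon(\sigma)z_{\sigma(1)}\cdots z_{\sigma(n)}$. A permutation $\sigma$ of $\{1,\dots,\widehat{i},\dots,n+1\}$ is written as an arrangement $\sigma(1),\sigma(2),\dots,\sigma(n)$ of these $n$ numbers, and $\epsilon(\sigma)$ is its sign relative to the increasing arrangement; "$1$ and $n+1$ do not appear consecutively" means they are not adjacent, in either order, in this arrangement. $F\langle X\rangle$ is the free unital associative algebra, with basis the words $X^*$. Degree-lexicographical order: $u<v$ iff $\deg u<\deg v$, or $\deg u=\deg v$ and at the first position where they differ $u$ has $x_i$ and $v$ has $x_j$ with $i<j$. $\mathrm{LM}(f)$ is the largest word occurring with nonzero coefficient in $f\ne0$. A word $u$ is a factor of $v$ if $v=w_1uw_2$ for some words $w_1,w_2$. A subset $G$ of a two-sided ideal $I$ is a Gröbner basis of $I$ if for every nonzero $f\in I$ there is $g\in G$ such that $\mathrm{LM}(g)$ is a factor of $\mathrm{LM}(f)$. *)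

theory Defs
  imports
    Complex_Main
    "HOL-Library.Poly_Mapping"
    "HOL-Library.Sublist"
    "HOL-Combinatorics.Permutations"
    "HOL-Algebra.Ideal"
begin

section \<open>n-Lie algebras\<close>

text \<open>
  The underlying vector space is a subspace \<open>V\<close> of the ambient space \<open>'v\<close>, so that its dimension
  may depend on \<open>n\<close>. The bracket takes a list of \<open>n\<close> elements of \<open>V\<close>; its values on other lists are
  irrelevant. Alternation is stated as vanishing on equal entries, which is the right notion also
  in characteristic 2.
\<close>

locale n_lie_algebra = vector_space scale
  for scale :: "'a::field \<Rightarrow> 'v::ab_group_add \<Rightarrow> 'v" +
  fixes V :: "'v set" and n :: nat and bracket :: "'v list \<Rightarrow> 'v"
  assumes subspace_V: "subspace V"
    and bracket_closed: "\<lbrakk>length zs = n; set zs \<subseteq> V\<rbrakk> \<Longrightarrow> bracket zs \<in> V"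
    and bracket_add:
      "\<lbrakk>length zs = n; set zs \<subseteq> V; i < n; u \<in> V; v \<in> V\<rbrakk>
        \<Longrightarrow> bracket (zs[i := u + v]) = bracket (zs[i := u]) + bracket (zs[i := v])"
    and bracket_scale:
      "\<lbrakk>length zs = n; set zs \<subseteq> V; i < n; u \<in> V\<rbrakk>
        \<Longrightarrow> bracket (zs[i := scale c u]) = scale c (bracket (zs[i := u]))"
    and bracket_alternating:
      "\<lbrakk>length zs = n; set zs \<subseteq> V; i < j; j < n; zs ! i = zs ! j\<rbrakk> \<Longrightarrow> bracket zs = 0"
    and fundamental_identity:
      "\<lbrakk>length zs = n; set zs \<subseteq> V; length ws = n - 1; set ws \<subseteq> V\<rbrakk>
        \<Longrightarrow> bracket (bracket zs # ws) = (\<Sum>i<n. bracket (zs[i := bracket (zs ! i # ws)]))"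

section \<open>The free unital associative algebra\<close>

text \<open>
  Words are lists, a monoid under concatenation; the convolution product of finitely supported
  functions on words is then the product of noncommutative polynomials. The letter \<open>i\<close> stands
  for \<open>x\<^sub>i\<close>.
\<close>

instantiation list :: (type) monoid_add
begin

definition zero_list :: "'a list" where "zero_list = []"

definition plus_list :: "'a list \<Rightarrow> 'a list \<Rightarrow> 'a list" where "plus_list u v = u @ v"

instance by standard (simp_all add: zero_list_def plus_list_def)

end

type_synonym 'a ncpoly = "nat list \<Rightarrow>\<^sub>0 'a"

definition var :: "nat \<Rightarrow> 'a::ring_1 ncpoly" where
  "var i = Poly_Mapping.single [i] 1"

definition free_algebra :: "nat set \<Rightarrow> 'a::ring_1 ncpoly ring" where
  "free_algebra X = \<lparr>carrier = {f. Poly_Mapping.keys f \<subseteq> lists X}, mult = (*), one = 1, zero = 0, add = (+)\<rparr>"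

lemma ring_free_algebra: "ring (free_algebra X :: 'a::ring_1 ncpoly ring)"
proof (rule ringI)
  show "abelian_group (free_algebra X :: 'a ncpoly ring)"
  proof (rule abelian_groupI)
    fix f assume "f \<in> carrier (free_algebra X :: 'a ncpoly ring)"
    then show "\<exists>g\<in>carrier (free_algebra X). g \<oplus>\<^bsub>free_algebra X\<^esub> f = \<zero>\<^bsub>free_algebra X\<^esub>"
      by (intro bexI[of _ "- f"]) (auto simp: free_algebra_def)
  qed (use keys_add in \<open>fastforce simp: free_algebra_def algebra_simps\<close>)+
  show "monoid (free_algebra X :: 'a ncpoly ring)"
  proof (rule monoidI)
    fix f g :: "'a ncpoly"
    assume "f \<in> carrier (free_algebra X :: 'a ncpoly ring)"
      and "g \<in> carrier (free_algebra X)"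
    then show "f \<otimes>\<^bsub>free_algebra X\<^esub> g \<in> carrier (free_algebra X)"
      using keys_mult[of f g] by (fastforce simp: free_algebra_def plus_list_def)
  next
    show "\<one>\<^bsub>free_algebra X\<^esub> \<in> carrier (free_algebra X :: 'a ncpoly ring)"
      by (simp add: free_algebra_def zero_list_def single_one[symmetric] del: single_one)
  qed (auto simp: free_algebra_def algebra_simps)
qed (auto simp: free_algebra_def algebra_simps)

section \<open>Leading words and Groebner bases\<close>

text \<open>
  \<open>lenlex less_than\<close> compares words first by length and then at the first differing letter.
\<close>

definition deglex_less :: "nat list \<Rightarrow> nat list \<Rightarrow> bool" where
  "deglex_less u v \<longleftrightarrow> (u, v) \<in> lenlex less_than"

definition LM :: "'a::zero ncpoly \<Rightarrow> nat list" where
  "LM f = (THE w. w \<in> Poly_Mapping.keys f \<and> (\<forall>v\<in>Poly_Mapping.keys f. v \<noteq> w \<longrightarrow> deglex_less v w))"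

definition is_groebner_basis :: "'a::zero ncpoly set \<Rightarrow> 'a ncpoly set \<Rightarrow> bool" where
  "is_groebner_basis B I \<longleftrightarrow>
     B \<subseteq> I \<and> (\<forall>f\<in>I. f \<noteq> 0 \<longrightarrow> (\<exists>g\<in>B. g \<noteq> 0 \<and> sublist (LM g) (LM f)))"

section \<open>The generators of the envelope and the Groebner basis elements\<close>

definition alt :: "'r::ring_1 list \<Rightarrow> 'r" where
  "alt zs = (\<Sum>p | p permutes {..<length zs}.
     of_int (sign p) * prod_list (map (\<lambda>k. zs ! p k) [0..<length zs]))"

definition omit :: "nat \<Rightarrow> nat \<Rightarrow> nat list" where
  "omit n i = filter (\<lambda>j. j \<noteq> i) [1..<n + 2]"

definition G :: "nat \<Rightarrow> nat \<Rightarrow> 'a::ring_1 ncpoly" where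
  "G n i = (-1) ^ (n div 2) * (alt (map var (omit n i)) - (if i = n + 1 then var 1 else 0))"

definition N :: "nat \<Rightarrow> 'a::ring_1 ncpoly" where
  "N n = var (n + 1) * var 1 - var 1 * var (n + 1)"

text \<open>
  For \<open>1 \<le> i \<le> n + 1\<close>, a permutation of \<open>omit n i\<close> is encoded by the permutation \<open>p\<close> of the
  positions \<open>0, \<dots>, n - 1\<close> that produces its arrangement from the increasing one; its sign
  relative to the increasing arrangement is \<open>sign p\<close>.
\<close>

definition arrangement :: "nat \<Rightarrow> nat \<Rightarrow> (nat \<Rightarrow> nat) \<Rightarrow> nat list" where
  "arrangement n i p = map (\<lambda>k. omit n i ! p k) [0..<n]"

definition adjacent_in :: "'b \<Rightarrow> 'b \<Rightarrow> 'b list \<Rightarrow> bool" where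
  "adjacent_in a b w \<longleftrightarrow> sublist [a, b] w \<or> sublist [b, a] w"

definition T :: "nat \<Rightarrow> nat \<Rightarrow> (nat \<Rightarrow> nat) set" where
  "T n i = {p. p permutes {..<n} \<and> \<not> adjacent_in 1 (n + 1) (arrangement n i p)}"

definition H :: "nat \<Rightarrow> nat \<Rightarrow> 'a::ring_1 ncpoly" where
  "H n i = (-1) ^ (n div 2) *
     (\<Sum>p\<in>T n i. of_int (sign p) * prod_list (map var (arrangement n i p)))"

end

theory Submission
  imports Defs "HOL-Combinatorics.Multiset_Permutations"
begin

text \<open>
  The proof is Bergman's diamond lemma together with one syzygy.

  Each element of the proposed basis is monic with a strictly decreasing leading word: \<open>G\<^sub>1\<close> and
  \<open>G\<^bsub>n+1\<^esub>\<close> lead with the decreasing word on all letters but \<open>1\<close>, respectively \<open>n + 1\<close>, \<open>H\<^sub>i\<close> with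
  the one on all letters but \<open>i\<close> (this is where \<open>n \<ge> 4\<close> enters: the letters \<open>n + 1\<close> and \<open>1\<close> stand
  at its ends, which must not be adjacent), and \<open>N\<close> with \<open>x\<^bsub>n+1\<^esub> x\<^sub>1\<close>. All of these words except
  \<open>x\<^sub>n \<dots> x\<^sub>1\<close> start with the greatest letter, so they can overlap in essentially one way: the leading
  words of \<open>G\<^sub>1\<close> and \<open>G\<^bsub>n+1\<^esub>\<close> overlap in \<open>x\<^sub>n \<dots> x\<^sub>2\<close>, which produces the composition
  \<open>G\<^sub>1 x\<^sub>1 - x\<^bsub>n+1\<^esub> G\<^bsub>n+1\<^esub>\<close> (\<open>rules_overlap_cases\<close>).

  To resolve it, expand the alternating sum over all \<open>n + 1\<close> letters along its first and along its last
  letter. For even \<open>n\<close> the two expansions carry the same signs, and subtracting them gives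
  \<open>\<Sum>\<^sub>i (-1)\<^sup>i\<^sup>-\<^sup>1 (x\<^sub>i G\<^sub>i - G\<^sub>i x\<^sub>i) = \<plusminus> N\<close> (\<open>signed_commutator_sum\<close>). This puts \<open>N\<close> into the ideal. Hence
  \<open>H\<^sub>i\<close> lies in it too: in \<open>G\<^sub>i\<close>, the words in which \<open>1\<close> and \<open>n + 1\<close> are adjacent pair up, by
  exchanging these two letters, into signed multiples \<open>u N v\<close>, and \<open>H\<^sub>i\<close> is what remains
  (\<open>G_eq_H_plus_N_multiples\<close>). Read the other way, the same identity writes the composition as a
  combination of multiples of basis elements whose leading words all precede \<open>x\<^bsub>n+1\<^esub> \<dots> x\<^sub>1\<close>: apart
  from the shorter one of \<open>N\<close>, they are arrangements of all \<open>n + 1\<close> letters, and the decreasing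
  arrangement is the greatest (\<open>overlap_resolves\<close>). The diamond lemma
  (\<open>groebner_if_overlaps_resolve\<close>) finishes the proof.
\<close>

section \<open>The degree-lexicographical order and leading words\<close>

lemma deglex_append: "deglex_less u v \<Longrightarrow> deglex_less (a @ u @ b) (a @ v @ b)"
  unfolding deglex_less_def
  by (auto simp: irrefl_def intro: lenlex_append1)

lemma deglex_trans: "deglex_less u v \<Longrightarrow> deglex_less v w \<Longrightarrow> deglex_less u w"
  unfolding deglex_less_def by (rule lenlex_trans) auto

lemma deglex_irrefl: "\<not> deglex_less u u"
  unfolding deglex_less_def by (rule lenlex_irreflexive) auto

lemma deglex_linear: "u \<noteq> v \<Longrightarrow> deglex_less u v \<or> deglex_less v u"
  using total_lenlex[OF total_less_than] by (simp add: deglex_less_def total_on_def)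

lemma wfp_deglex: "wfP deglex_less"
  unfolding deglex_less_def wfp_def by (simp add: wf_lenlex)

definition monic_at :: "'a::zero_neq_one ncpoly \<Rightarrow> nat list \<Rightarrow> bool" where
  "monic_at g l \<longleftrightarrow> Poly_Mapping.lookup g l = 1 \<and> (\<forall>k\<in>Poly_Mapping.keys g. k \<noteq> l \<longrightarrow> deglex_less k l)"

lemma LM_eqI:
  assumes "w \<in> Poly_Mapping.keys f" and "\<And>v. v \<in> Poly_Mapping.keys f \<Longrightarrow> v \<noteq> w \<Longrightarrow> deglex_less v w"
  shows "LM f = w"
  unfolding LM_def
proof (rule the_equality)
  show "w \<in> Poly_Mapping.keys f \<and> (\<forall>v\<in>Poly_Mapping.keys f. v \<noteq> w \<longrightarrow> deglex_less v w)"
    using assms by simp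
  show "w' = w" if "w' \<in> Poly_Mapping.keys f \<and> (\<forall>v\<in>Poly_Mapping.keys f. v \<noteq> w' \<longrightarrow> deglex_less v w')" for w'
    using that assms(1) assms(2)[of w'] deglex_trans[of w w' w] deglex_irrefl[of w] by metis
qed

lemma LM_monic_at:
  assumes "monic_at g l"
  shows "LM g = l"
proof (rule LM_eqI)
  show "l \<in> Poly_Mapping.keys g"
    using assms unfolding monic_at_def in_keys_iff by simp
  show "deglex_less v l" if "v \<in> Poly_Mapping.keys g" "v \<noteq> l" for v
    using assms that unfolding monic_at_def by blast
qed

lemma monic_at_nonzero:
  assumes "monic_at g l"
  shows "g \<noteq> 0"
proof
  assume "g = 0"
  with assms have "Poly_Mapping.lookup 0 l = (1 :: 'a)" by (simp only: monic_at_def)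
  then show False by simp
qed

section \<open>Combinations of multiples bounded by their leading words\<close>

lemma single_mult_single:
  "Poly_Mapping.single u c * Poly_Mapping.single v d = Poly_Mapping.single (u @ v) (c * d :: 'a::semiring_0)"
  by (simp add: mult_single plus_list_def)

lemma single_Nil [simp]: "Poly_Mapping.single [] 1 = (1 :: 'a::semiring_1 ncpoly)"
  unfolding zero_list_def[symmetric] by (rule single_one)

lemma sum_single_lookup: "(\<Sum>k\<in>Poly_Mapping.keys f. Poly_Mapping.single k (Poly_Mapping.lookup f k)) = f"
  by (rule poly_mapping_eqI)
     (simp add: lookup_sum lookup_single when_def in_keys_iff)

lemma scalar_central:
  fixes f :: "'a::comm_ring_1 ncpoly"
  shows "f * Poly_Mapping.single [] c = Poly_Mapping.single [] c * f"
proof -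
  have "(\<Sum>k\<in>Poly_Mapping.keys f. Poly_Mapping.single k (Poly_Mapping.lookup f k)) * Poly_Mapping.single [] c
     = Poly_Mapping.single [] c * (\<Sum>k\<in>Poly_Mapping.keys f. Poly_Mapping.single k (Poly_Mapping.lookup f k))"
    by (simp add: sum_distrib_left sum_distrib_right single_mult_single mult.commute)
  then show ?thesis by (simp add: sum_single_lookup)
qed

lemma scalar_move:
  fixes f :: "'a::comm_ring_1 ncpoly"
  shows "Poly_Mapping.single u c * f * Poly_Mapping.single v d
       = Poly_Mapping.single u (c * d) * f * Poly_Mapping.single v 1"
proof -
  have "Poly_Mapping.single v d = Poly_Mapping.single [] d * Poly_Mapping.single v 1"
    by (simp add: single_mult_single)
  then have "Poly_Mapping.single u c * f * Poly_Mapping.single v d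
      = Poly_Mapping.single u c * (f * Poly_Mapping.single [] d) * Poly_Mapping.single v 1"
    by (simp add: mult.assoc)
  also have "\<dots> = Poly_Mapping.single u (c * d) * f * Poly_Mapping.single v 1"
    by (simp add: scalar_central mult.assoc[symmetric] single_mult_single mult.commute)
  finally show ?thesis .
qed

text \<open>
  A pair \<open>(l, g)\<close> in \<open>R\<close> stands for a polynomial \<open>g\<close> with leading word \<open>l\<close>, and \<open>P\<close> bounds the leading
  words \<open>u @ l @ v\<close> of the multiples that may be combined. Taking \<open>P\<close> constantly true gives the
  two-sided ideal; bounding by a word \<open>w\<close> from above gives the combinations modulo which a composition at \<open>w\<close> has
  to vanish.
\<close>

inductive_set combos :: "(nat list \<times> 'a::comm_ring_1 ncpoly) set \<Rightarrow> (nat list \<Rightarrow> bool) \<Rightarrow> 'a ncpoly set"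
  for R P where
    zero: "0 \<in> combos R P"
  | step: "\<lbrakk>f \<in> combos R P; (l, g) \<in> R; P (u @ l @ v)\<rbrakk>
      \<Longrightarrow> f + Poly_Mapping.single u c * g * Poly_Mapping.single v 1 \<in> combos R P"

lemma combos_term:
  "(l, g) \<in> R \<Longrightarrow> P (u @ l @ v) \<Longrightarrow> Poly_Mapping.single u c * g * Poly_Mapping.single v d \<in> combos R P"
  using combos.step[OF combos.zero] by (subst scalar_move) force

lemma combos_add:
  assumes "f \<in> combos R P" "h \<in> combos R P"
  shows "f + h \<in> combos R P"
  using assms(2,1) by (induction) (auto simp: add.assoc[symmetric] intro: combos.step)

lemma combos_mult:
  assumes "f \<in> combos R P" "\<And>w. P w \<Longrightarrow> Q (a @ w @ b)"
  shows "Poly_Mapping.single a c * f * Poly_Mapping.single b d \<in> combos R Q"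
  using assms(1)
proof induction
  case zero
  then show ?case by (simp add: combos.zero)
next
  case (step f l g u v e)
  have "Poly_Mapping.single a c * (Poly_Mapping.single u e * g * Poly_Mapping.single v 1) * Poly_Mapping.single b d
      = Poly_Mapping.single (a @ u) (c * e) * g * Poly_Mapping.single (v @ b) d"
    by (simp add: single_mult_single mult.assoc[symmetric]) (simp add: single_mult_single mult.assoc)
  moreover have "\<dots> \<in> combos R Q"
    using step assms(2) by (intro combos_term) force+
  ultimately show ?case
    using step.IH by (simp add: algebra_simps combos_add)
qed

lemma combos_uminus: "f \<in> combos R P \<Longrightarrow> - f \<in> combos R P"
  using combos_mult[of f R P P "[]" "[]" "- 1" 1] 
  by (simp add: single_uminus)

lemma combos_diff: "f \<in> combos R P \<Longrightarrow> h \<in> combos R P \<Longrightarrow> f - h \<in> combos R P"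
  using combos_add[OF _ combos_uminus] by force

lemma combos_sum: "(\<And>i. i \<in> I \<Longrightarrow> f i \<in> combos R P) \<Longrightarrow> sum f I \<in> combos R P"
  by (induction I rule: infinite_finite_induct) (auto intro: combos.zero combos_add)

lemma combos_mono: "f \<in> combos R P \<Longrightarrow> (\<And>w. P w \<Longrightarrow> Q w) \<Longrightarrow> f \<in> combos R Q"
  by (induction rule: combos.induct) (auto intro: combos.intros)

text \<open>
  A whole polynomial \<open>q\<close> may stand in a context as long as each of its words meets the bound. This is
  applied to the tail of another basis element to the left of \<open>g\<close>; the next lemma is its mirror image.
\<close>

lemma combos_between:
  assumes "(l, g) \<in> R" "\<And>k. k \<in> Poly_Mapping.keys q \<Longrightarrow> P (a @ k @ b @ l @ v)"
  shows "Poly_Mapping.single a 1 * q * Poly_Mapping.single b 1 * g * Poly_Mapping.single v 1 \<in> combos R P"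
proof -
  have "(\<Sum>k\<in>Poly_Mapping.keys q. Poly_Mapping.single (a @ k @ b) (Poly_Mapping.lookup q k) * g * Poly_Mapping.single v 1) \<in> combos R P"
    using assms by (intro combos_sum combos_term) auto
  also have "(\<Sum>k\<in>Poly_Mapping.keys q. Poly_Mapping.single (a @ k @ b) (Poly_Mapping.lookup q k) * g * Poly_Mapping.single v 1)
     = Poly_Mapping.single a 1 * (\<Sum>k\<in>Poly_Mapping.keys q. Poly_Mapping.single k (Poly_Mapping.lookup q k)) * Poly_Mapping.single b 1 * g * Poly_Mapping.single v 1"
    by (simp add: sum_distrib_left sum_distrib_right single_mult_single)
  finally show ?thesis by (simp add: sum_single_lookup)
qed

lemma combos_between':
  assumes "(l, g) \<in> R" "\<And>k. k \<in> Poly_Mapping.keys q \<Longrightarrow> P (a @ l @ b @ k @ v)"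
  shows "Poly_Mapping.single a 1 * g * Poly_Mapping.single b 1 * q * Poly_Mapping.single v 1 \<in> combos R P"
proof -
  have "(\<Sum>k\<in>Poly_Mapping.keys q. Poly_Mapping.single a 1 * g * Poly_Mapping.single (b @ k @ v) (Poly_Mapping.lookup q k)) \<in> combos R P"
    using assms by (intro combos_sum combos_term) auto
  also have "(\<Sum>k\<in>Poly_Mapping.keys q. Poly_Mapping.single a 1 * g * Poly_Mapping.single (b @ k @ v) (Poly_Mapping.lookup q k))
     = Poly_Mapping.single a 1 * g * Poly_Mapping.single b 1 * (\<Sum>k\<in>Poly_Mapping.keys q. Poly_Mapping.single k (Poly_Mapping.lookup q k)) * Poly_Mapping.single v 1"
    by (simp add: sum_distrib_left sum_distrib_right single_mult_single mult.assoc)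
  finally show ?thesis by (simp add: sum_single_lookup)
qed

section \<open>The diamond lemma\<close>

lemma tail_less:
  fixes g :: "'a::comm_ring_1 ncpoly"
  assumes "monic_at g l" "k \<in> Poly_Mapping.keys (g - Poly_Mapping.single l 1)"
  shows "deglex_less k l"
  using assms by (cases "k = l") (auto simp: monic_at_def in_keys_iff lookup_minus lookup_single when_def)

text \<open>
  Put \<open>t = g - l\<close> and \<open>t' = g' - l'\<close>. Both \<open>g b l'\<close> and \<open>l b g'\<close> differ from \<open>g b g'\<close> only by a multiple of
  a tail, so their difference is \<open>t b g' - g b t'\<close>, and both terms have smaller leading words.
\<close>

lemma disjoint_occurrences_resolve:
  fixes g g' :: "'a::comm_ring_1 ncpoly"
  assumes R: "(l, g) \<in> R" "(l', g') \<in> R" and monic: "monic_at g l" "monic_at g' l'"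
  shows "g * Poly_Mapping.single (b @ l' @ v) 1 - Poly_Mapping.single (l @ b) 1 * g' * Poly_Mapping.single v 1
    \<in> combos R (\<lambda>z. deglex_less z (l @ b @ l' @ v))"
proof -
  let ?s = "\<lambda>u. Poly_Mapping.single u (1::'a)"
  define t t' where "t = g - ?s l" and "t' = g' - ?s l'"
  have l: "?s l = g - t" "?s l' = g' - t'" by (simp_all add: t_def t'_def)
  have "?s [] * t * ?s b * g' * ?s v \<in> combos R (\<lambda>z. deglex_less z (l @ b @ l' @ v))"
    using tail_less[OF monic(1)] deglex_append[of _ l "[]" "b @ l' @ v"]
    by (intro combos_between[OF R(2)]) (auto simp: t_def)
  moreover have "?s [] * g * ?s b * t' * ?s v \<in> combos R (\<lambda>z. deglex_less z (l @ b @ l' @ v))"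
    using tail_less[OF monic(2)] deglex_append[of _ l' "l @ b" v]
    by (intro combos_between'[OF R(1)]) (auto simp: t'_def)
  moreover have "g * ?s (b @ l' @ v) - ?s (l @ b) * g' * ?s v
      = ?s [] * t * ?s b * g' * ?s v - ?s [] * g * ?s b * t' * ?s v"
  proof -
    have "g * ?s (b @ l' @ v) - ?s (l @ b) * g' * ?s v
        = g * ?s b * ?s l' * ?s v - ?s l * ?s b * g' * ?s v"
      by (simp add: single_mult_single mult.assoc)
    also have "\<dots> = t * ?s b * g' * ?s v - g * ?s b * t' * ?s v"
      unfolding l by (simp add: algebra_simps)
    finally show ?thesis by simp
  qed
  ultimately show ?thesis by (simp add: combos_diff)
qed

text \<open>
  A combination is a finite sum, so one of its multiples has the greatest leading word.
\<close>

lemma combos_top: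
  fixes f :: "'a::comm_ring_1 ncpoly"
  assumes "f \<in> combos R P"
  shows "f = 0 \<or> (\<exists>w. P w \<and> f \<in> combos R (\<lambda>z. z = w \<or> deglex_less z w))"
  using assms
proof induction
  case zero
  then show ?case by simp
next
  case (step f l g u v c)
  let ?w = "u @ l @ v" and ?t = "Poly_Mapping.single u c * g * Poly_Mapping.single v 1"
  have t: "?t \<in> combos R (\<lambda>z. z = ?w \<or> deglex_less z ?w)"
    using step by (intro combos_term) auto
  from step.IH show ?case
  proof (elim disjE exE conjE)
    assume "f = 0"
    then show ?thesis using t step by auto
  next
    fix w assume w: "P w" "f \<in> combos R (\<lambda>z. z = w \<or> deglex_less z w)"
    consider "w = ?w \<or> deglex_less w ?w" | "deglex_less ?w w"
      using deglex_linear by blast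
    then show ?thesis
    proof cases
      case 1
      then have "f \<in> combos R (\<lambda>z. z = ?w \<or> deglex_less z ?w)"
        using w(2) deglex_trans by (elim combos_mono) blast
      then show ?thesis using t step combos_add by blast
    next
      case 2
      then have "?t \<in> combos R (\<lambda>z. z = w \<or> deglex_less z w)"
        using t deglex_trans by (elim combos_mono) blast
      then show ?thesis using w combos_add by blast
    qed
  qed
qed

lemma keys_term:
  fixes g :: "'a::comm_ring_1 ncpoly"
  assumes "k \<in> Poly_Mapping.keys (Poly_Mapping.single u c * g * Poly_Mapping.single v d)"
  shows "\<exists>w\<in>Poly_Mapping.keys g. k = u @ w @ v"
proof -
  from assms keys_mult obtain k' b where "k' \<in> Poly_Mapping.keys (Poly_Mapping.single u c * g)"
    "b \<in> Poly_Mapping.keys (Poly_Mapping.single v d)" "k = k' + b" by blast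
  moreover from this(1) keys_mult obtain a w where "a \<in> Poly_Mapping.keys (Poly_Mapping.single u c)"
    "w \<in> Poly_Mapping.keys g" "k' = a + w" by blast
  ultimately show ?thesis by (auto simp: plus_list_def split: if_splits)
qed

lemma lookup_term:
  fixes g :: "'a::comm_ring_1 ncpoly"
  shows "Poly_Mapping.lookup (Poly_Mapping.single u c * g * Poly_Mapping.single v d) (u @ w @ v)
    = c * Poly_Mapping.lookup g w * d"
proof -
  have "Poly_Mapping.single u c * g * Poly_Mapping.single v d = Poly_Mapping.single u c *
      (\<Sum>k\<in>Poly_Mapping.keys g. Poly_Mapping.single k (Poly_Mapping.lookup g k)) * Poly_Mapping.single v d"
    by (simp add: sum_single_lookup)
  also have "\<dots> = (\<Sum>k\<in>Poly_Mapping.keys g. Poly_Mapping.single (u @ k @ v) (c * Poly_Mapping.lookup g k * d))"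
    by (simp add: sum_distrib_left sum_distrib_right single_mult_single)
  finally show ?thesis
    by (simp add: lookup_sum lookup_single when_def in_keys_iff)
qed

lemma keys_combos_less:
  fixes f :: "'a::comm_ring_1 ncpoly"
  assumes "\<And>l g. (l, g) \<in> R \<Longrightarrow> monic_at g l"
    and "f \<in> combos R (\<lambda>z. deglex_less z w)" "k \<in> Poly_Mapping.keys f"
  shows "deglex_less k w"
  using assms(2,3)
proof (induction arbitrary: k)
  case zero
  then show ?case by simp
next
  case (step f l g u v c)
  from subsetD[OF keys_add step.prems]
  have "k \<in> Poly_Mapping.keys f \<or> k \<in> Poly_Mapping.keys (Poly_Mapping.single u c * g * Poly_Mapping.single v 1)"
    by simp
  then show ?case
  proof
    assume "k \<in> Poly_Mapping.keys (Poly_Mapping.single u c * g * Poly_Mapping.single v 1)"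
    from keys_term[OF this] obtain m where "m \<in> Poly_Mapping.keys g" "k = u @ m @ v" by blast
    then have "k = u @ l @ v \<or> deglex_less k (u @ l @ v)"
      using assms(1)[OF step.hyps(2)] deglex_append unfolding monic_at_def by blast
    then show ?thesis
    proof
      assume "deglex_less k (u @ l @ v)"
      then show ?thesis using step.hyps(3) by (rule deglex_trans)
    qed (use step.hyps(3) in simp)
  next
    assume "k \<in> Poly_Mapping.keys f"
    then show ?thesis by (rule step.IH)
  qed
qed

lemma append_eq_split:
  assumes "xs @ ys = zs @ ts" "length xs \<le> length zs"
  obtains us where "zs = xs @ us" "ys = us @ ts"
proof
  have split: "xs = take (length xs) zs \<and> ys = drop (length xs) zs @ ts"
    using assms by (simp add: append_eq_append_conv_if)
  then show "zs = xs @ drop (length xs) zs"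
    using append_take_drop_id[of "length xs" zs] by simp
  show "ys = drop (length xs) zs @ ts" using split by simp
qed

text \<open>
  Two occurrences of leading words in one word \<open>w\<close> either overlap, which is the hypothesis, or are
  disjoint, so any two multiples with leading word \<open>w\<close> agree modulo multiples with leading words
  below \<open>w\<close>. A combination bounded by \<open>w\<close> therefore needs at most one multiple
  \<open>c u g v\<close> that reaches \<open>w\<close>. If \<open>c \<noteq> 0\<close>, then nothing cancels \<open>w\<close>, which is the leading word of the
  combination. Otherwise the bound can be lowered, and the order is well-founded.
\<close>

lemma groebner_if_overlaps_resolve:
  fixes f :: "'a::comm_ring_1 ncpoly"
  assumes monic: "\<And>l g. (l, g) \<in> R \<Longrightarrow> monic_at g l"
    and overlap: "\<And>l g l' g' u v v'. \<lbrakk>(l, g) \<in> R; (l', g') \<in> R; l @ v = u @ l' @ v'; length u < length l\<rbrakk>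
      \<Longrightarrow> g * Poly_Mapping.single v 1 - Poly_Mapping.single u 1 * g' * Poly_Mapping.single v' 1
        \<in> combos R (\<lambda>z. deglex_less z (l @ v))"
    and f: "f \<in> combos R (\<lambda>_. True)" "f \<noteq> 0"
  shows "\<exists>(l, g)\<in>R. sublist l (LM f)"
proof -
  let ?s = "\<lambda>u. Poly_Mapping.single u (1::'a)"
  \<comment> \<open>Stripping the common prefix \<open>u\<close> leaves occurrences that either overlap or are disjoint.\<close>
  have left: "?s u * g * ?s v - ?s u' * g' * ?s v' \<in> combos R (\<lambda>z. deglex_less z (u @ l @ v))"
    if R: "(l, g) \<in> R" "(l', g') \<in> R" and eq: "u @ l @ v = u' @ l' @ v'" and le: "length u \<le> length u'"
    for l g l' g' u v u' v'
  proof -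
    from eq le obtain r where r: "u' = u @ r" "l @ v = r @ l' @ v'"
      by (auto dest: append_eq_split)
    have "g * ?s v - ?s r * g' * ?s v' \<in> combos R (\<lambda>z. deglex_less z (l @ v))"
    proof (cases "length r < length l")
      case True
      then show ?thesis using overlap R r(2) by blast
    next
      case False
      with r(2) obtain b where "r = l @ b" "v = b @ l' @ v'"
        using append_eq_split[of l v r "l' @ v'"] by auto
      then show ?thesis using disjoint_occurrences_resolve[OF R monic[OF R(1)] monic[OF R(2)]] by simp
    qed
    then have "?s u * (g * ?s v - ?s r * g' * ?s v') * ?s [] \<in> combos R (\<lambda>z. deglex_less z (u @ l @ v))"
      by (rule combos_mult) (use deglex_append[of _ _ u "[]"] in auto)
    moreover have "?s u * (g * ?s v - ?s r * g' * ?s v') * ?s [] = ?s u * g * ?s v - ?s u' * g' * ?s v'"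
      by (simp add: algebra_simps r(1) single_mult_single)
         (simp add: single_mult_single flip: mult.assoc)
    ultimately show ?thesis by simp
  qed
  have resolve: "?s u * g * ?s v - ?s u' * g' * ?s v' \<in> combos R (\<lambda>z. deglex_less z (u @ l @ v))"
    if "(l, g) \<in> R" "(l', g') \<in> R" "u @ l @ v = u' @ l' @ v'" for l g l' g' u v u' v'
  proof (cases "length u \<le> length u'")
    case True
    then show ?thesis using left that by blast
  next
    case False
    then have "- (?s u' * g' * ?s v' - ?s u * g * ?s v) \<in> combos R (\<lambda>z. deglex_less z (u @ l @ v))"
      using left[of l' g' l g u' v' u v] that by (intro combos_uminus) simp
    then show ?thesis by simp
  qed
  \<comment> \<open>All multiples that reach \<open>w\<close> are collected into a single one.\<close>
  have top: "f \<in> combos R (\<lambda>z. deglex_less z w) \<or> (\<exists>u l v g c. (l, g) \<in> R \<and> w = u @ l @ v \<and>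
      f - Poly_Mapping.single u c * g * ?s v \<in> combos R (\<lambda>z. deglex_less z w))"
    if "f \<in> combos R (\<lambda>z. z = w \<or> deglex_less z w)" for f w
    using that
  proof induction
    case zero
    then show ?case by (simp add: combos.zero)
  next
    case (step f l g u v c)
    let ?t = "Poly_Mapping.single u c * g * ?s v"
    show ?case
    proof (cases "u @ l @ v = w")
      case False
      then have t: "?t \<in> combos R (\<lambda>z. deglex_less z w)"
        using step by (intro combos_term) auto
      from step.IH show ?thesis
      proof (elim disjE exE conjE)
        assume "f \<in> combos R (\<lambda>z. deglex_less z w)"
        then show ?thesis using t combos_add by blast
      next
        fix u' l' v' g' c'
        assume *: "(l', g') \<in> R" "w = u' @ l' @ v'"
          and "f - Poly_Mapping.single u' c' * g' * ?s v' \<in> combos R (\<lambda>z. deglex_less z w)"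
        from combos_add[OF this(3) t]
        have "f + ?t - Poly_Mapping.single u' c' * g' * ?s v' \<in> combos R (\<lambda>z. deglex_less z w)"
          by (simp add: algebra_simps)
        then show ?thesis using * by blast
      qed
    next
      case True
      from step.IH show ?thesis
      proof (elim disjE exE conjE)
        assume "f \<in> combos R (\<lambda>z. deglex_less z w)"
        then have "f + ?t - ?t \<in> combos R (\<lambda>z. deglex_less z w)" by simp
        then show ?thesis using True step.hyps(2) by blast
      next
        fix u' l' v' g' c'
        assume *: "(l', g') \<in> R" "w = u' @ l' @ v'"
          and d: "f - Poly_Mapping.single u' c' * g' * ?s v' \<in> combos R (\<lambda>z. deglex_less z w)"
        have "?s u * g * ?s v - ?s u' * g' * ?s v' \<in> combos R (\<lambda>z. deglex_less z w)"
          using resolve[OF step.hyps(2) *(1)] True *(2) by simp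
        then have "Poly_Mapping.single [] c * (?s u * g * ?s v - ?s u' * g' * ?s v') * ?s []
            \<in> combos R (\<lambda>z. deglex_less z w)"
          by (rule combos_mult) simp
        moreover have "Poly_Mapping.single [] c * (?s u * g * ?s v - ?s u' * g' * ?s v') * ?s []
            = ?t - Poly_Mapping.single u' c * g' * ?s v'"
          by (simp add: right_diff_distrib flip: mult.assoc)
            (simp add: single_mult_single)
        ultimately have "?t - Poly_Mapping.single u' c * g' * ?s v' \<in> combos R (\<lambda>z. deglex_less z w)"
          by simp
        from combos_add[OF d this]
        have "f + ?t - Poly_Mapping.single u' (c' + c) * g' * ?s v' \<in> combos R (\<lambda>z. deglex_less z w)"
          by (simp add: single_add algebra_simps)
        then show ?thesis using * by blast
      qed
    qed
  qed
  have main: "\<exists>(l, g)\<in>R. sublist l (LM f)" if "f \<in> combos R (\<lambda>z. z = w \<or> deglex_less z w)" "f \<noteq> 0" for w f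
    using that
  proof (induction w arbitrary: f rule: wfp_induct_rule[OF wfp_deglex])
    case (1 w)
    have down: ?case if "f \<in> combos R (\<lambda>z. deglex_less z w)"
      using combos_top[OF that] 1 by blast
    from top[OF "1.prems"(1)] show ?case
    proof (elim disjE exE conjE)
      fix u l v g c
      assume lg: "(l, g) \<in> R" and w: "w = u @ l @ v"
      let ?t = "Poly_Mapping.single u c * g * ?s v"
      assume d: "f - ?t \<in> combos R (\<lambda>z. deglex_less z w)"
      show ?thesis
      proof (cases "c = 0")
        case True
        then show ?thesis using d down by simp
      next
        case False
        have rest: "deglex_less k w" if "k \<in> Poly_Mapping.keys (f - ?t)" for k
          using keys_combos_less[OF monic d that] by simp
        have t: "k = w \<or> deglex_less k w" if "k \<in> Poly_Mapping.keys ?t" for k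
          using keys_term[OF that] monic[OF lg] deglex_append w by (fastforce simp: monic_at_def)
        have "Poly_Mapping.lookup (f - ?t) w = 0"
          using rest deglex_irrefl by (auto simp: in_keys_iff)
        then have "Poly_Mapping.lookup f w = c"
          using lookup_term[of u c g v 1 l] monic[OF lg] by (simp add: lookup_minus w monic_at_def)
        moreover have "deglex_less k w" if "k \<in> Poly_Mapping.keys f" "k \<noteq> w" for k
          using that rest t keys_add[of "f - ?t" ?t] by auto
        ultimately have "LM f = w"
          using False by (intro LM_eqI) (auto simp: in_keys_iff)
        then show ?thesis using lg w by (auto intro!: bexI[of _ "(l, g)"] simp: sublist_appendI)
      qed
    qed (rule down)
  qed
  from combos_top[OF f(1)] f(2) show ?thesis using main by blast
qed

section \<open>Signs of words\<close>

text \<open>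
  For words without repeated letters this is \<open>-1\<close> to the number of inversions. Working with words
  rather than with position permutations makes the expansion along the first letter the recursion
  equation itself.
\<close>

fun word_sign :: "nat list \<Rightarrow> int" where
  "word_sign [] = 1"
| "word_sign (a # w) = (-1) ^ length (filter (\<lambda>b. b < a) w) * word_sign w"

lemma word_sign_snoc: "word_sign (w @ [a]) = (-1) ^ length (filter (\<lambda>b. a < b) w) * word_sign w"
  by (induction w) (auto simp: power_add)

lemma word_sign_swap_adjacent: "a \<noteq> b \<Longrightarrow> word_sign (u @ a # b # v) = - word_sign (u @ b # a # v)"
  by (induction u) (auto simp: power_add)

lemma word_sign_move: "a \<notin> set m \<Longrightarrow> word_sign (u @ a # m @ v) = (-1) ^ length m * word_sign (u @ m @ a # v)"
proof (induction m arbitrary: u)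
  case (Cons c m)
  then show ?case
    using Cons.IH[of "u @ [c]"] word_sign_swap_adjacent[of a c u "m @ v"] by simp
qed simp

lemma word_sign_transpose:
  assumes "distinct (u @ a # m @ b # v)"
  shows "word_sign (u @ b # m @ a # v) = - word_sign (u @ a # m @ b # v)"
  using assms word_sign_move[of a m u "b # v"] word_sign_move[of b m u "a # v"]
    word_sign_swap_adjacent[of a b "u @ m" v] by simp

lemma word_sign_sorted: "sorted w \<Longrightarrow> word_sign w = 1"
proof (induction w)
  case (Cons a w)
  then have "filter (\<lambda>b. b < a) w = []" by (auto simp: filter_empty_conv)
  with Cons show ?case by simp
qed simp

text \<open>
  A decreasing word of length \<open>k\<close> has \<open>k * (k - 1) div 2\<close> inversions, a number with the parity of \<open>k div 2\<close>.
  This is why the factor \<open>(-1)\<^bsup>n div 2\<^esup>\<close> makes the generators monic.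
\<close>

lemma word_sign_decreasing: "sorted_wrt (>) w \<Longrightarrow> word_sign w = (-1) ^ (length w div 2)"
proof (induction w)
  case (Cons a w)
  then have "filter (\<lambda>b. b < a) w = w" by simp
  with Cons show ?case by (cases "even (length w)") auto
qed simp

lemma permute_list_transpose:
  assumes "i < j" "j < length ys"
  obtains u x m y v where "ys = u @ x # m @ y # v"
    "permute_list (Transposition.transpose i j) ys = u @ y # m @ x # v"
proof -
  let ?u = "take i ys" and ?v = "drop (Suc j) ys" and ?m = "take (j - Suc i) (drop (Suc i) ys)"
  have "drop (Suc i) ys = ?m @ ys ! j # ?v"
    using assms id_take_nth_drop[of "j - Suc i" "drop (Suc i) ys"] by simp
  then have ys: "ys = ?u @ ys ! i # ?m @ ys ! j # ?v"
    using assms id_take_nth_drop[of i ys] by simp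
  have "permute_list (Transposition.transpose i j) ys = ys[i := ys ! j, j := ys ! i]"
    using assms by (intro nth_equalityI)
      (auto simp: permute_list_def nth_list_update Transposition.transpose_def)
  also have "\<dots> = (?u @ ys ! i # ?m @ ys ! j # ?v)[i := ys ! j, j := ys ! i]"
    using ys by simp
  also have "\<dots> = ?u @ ys ! j # ?m @ ys ! i # ?v"
  proof -
    have len: "length ?u = i" "length ?m = j - Suc i" using assms by simp_all
    have ex: "(u @ x # m @ y # v)[i := y', j := x'] = u @ y' # m @ x' # v"
      if "length u = i" "length m = j - Suc i" for u m v :: "'a list" and x y x' y'
      using that assms by (auto simp: list_update_append nat.split Suc_diff_Suc split: nat.splits)
    show ?thesis by (rule ex) (fact len)+
  qed
  finally show ?thesis using ys that by blast
qed

text \<open>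
  Both sides change sign under a transposition of two positions.
\<close>

lemma word_sign_permute_list:
  assumes "distinct xs" "sorted xs" "p permutes {..<length xs}"
  shows "word_sign (permute_list p xs) = sign p"
  using finite_lessThan assms(3)
proof (induction rule: permutes_rev_induct)
  case id
  then show ?case using assms by (simp add: word_sign_sorted)
next
  case (swap a b p)
  have flip: "word_sign (permute_list (Transposition.transpose i j) (permute_list p xs)) = - word_sign (permute_list p xs)"
    if "i < j" "j < length xs" for i j
  proof -
    have "j < length (permute_list p xs)" using that by simp
    from permute_list_transpose[OF that(1) this] obtain u x m y v
      where "permute_list p xs = u @ x # m @ y # v"
        "permute_list (Transposition.transpose i j) (permute_list p xs) = u @ y # m @ x # v" .
    moreover have "distinct (permute_list p xs)" using assms swap by simp
    ultimately show ?thesis using word_sign_transpose[of u x m y v] by simp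
  qed
  have "permute_list (p \<circ> Transposition.transpose a b) xs
      = permute_list (Transposition.transpose a b) (permute_list p xs)"
    using swap by (intro permute_list_compose permutes_swap_id) auto
  moreover have "word_sign \<dots> = - word_sign (permute_list p xs)"
  proof (cases "a < b")
    case False
    then show ?thesis using flip[of b a] swap by (simp add: transpose_commute)
  qed (use flip swap in simp)
  moreover have "sign (p \<circ> Transposition.transpose a b) = - sign p"
    using swap by (simp add: sign_compose permutes_imp_permutation[OF finite_lessThan] permutation_swap_id sign_swap_id)
  ultimately show ?case using swap.IH by (simp only:)
qed

lemma bij_betw_permute_list:
  assumes "distinct xs"
  shows "bij_betw (\<lambda>p. permute_list p xs) {p. p permutes {..<length xs}} (permutations_of_set (set xs))"
  unfolding bij_betw_def
proof
  show "inj_on (\<lambda>p. permute_list p xs) {p. p permutes {..<length xs}}"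
  proof (rule inj_onI, clarify, rule ext)
    fix p q k
    assume pq: "p permutes {..<length xs}" "q permutes {..<length xs}" and eq: "permute_list p xs = permute_list q xs"
    show "p k = q k"
    proof (cases "k < length xs")
      case True
      then have "xs ! p k = xs ! q k"
        using arg_cong[OF eq, of "\<lambda>ys. ys ! k"] by (simp add: permute_list_nth pq)
      moreover have "p k < length xs" "q k < length xs"
        using True permutes_in_image[OF pq(1), of k] permutes_in_image[OF pq(2), of k] by simp_all
      ultimately show ?thesis
        using assms by (simp add: nth_eq_iff_index_eq)
    qed (use pq in \<open>simp add: permutes_not_in\<close>)
  qed
  show "(\<lambda>p. permute_list p xs) ` {p. p permutes {..<length xs}} = permutations_of_set (set xs)"
  proof (intro equalityI subsetI)
    fix w assume "w \<in> permutations_of_set (set xs)"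
    then have "mset w = mset xs"
      using assms set_eq_iff_mset_eq_distinct[of w xs] by (simp add: permutations_of_set_def)
    then show "w \<in> (\<lambda>p. permute_list p xs) ` {p. p permutes {..<length xs}}"
      by (elim mset_eq_permutation) blast
  qed (use assms in \<open>auto intro: permutations_of_setI\<close>)
qed

section \<open>Alternating sums over words\<close>

definition skew :: "(nat list \<Rightarrow> bool) \<Rightarrow> nat set \<Rightarrow> 'a::comm_ring_1 ncpoly" where
  "skew Q A = (\<Sum>w | w \<in> permutations_of_set A \<and> Q w. Poly_Mapping.single w (of_int (word_sign w)))"

abbreviation full_skew :: "nat set \<Rightarrow> 'a::comm_ring_1 ncpoly" where
  "full_skew \<equiv> skew (\<lambda>_. True)"

lemma prod_list_var: "prod_list (map var w) = (Poly_Mapping.single w 1 :: 'a::comm_ring_1 ncpoly)"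
  by (induction w) (simp_all add: var_def single_mult_single)

lemma of_int_mult_single:
  "of_int c * Poly_Mapping.single w d = (Poly_Mapping.single w (of_int c * d) :: 'a::comm_ring_1 ncpoly)"
proof -
  have "(of_int c :: 'a ncpoly) = Poly_Mapping.single [] (of_int c)"
    unfolding zero_list_def[symmetric] by simp
  then show ?thesis by (simp add: single_mult_single)
qed

lemma sum_permutes_eq_skew:
  assumes "distinct xs" "sorted xs"
  shows "(\<Sum>p | p permutes {..<length xs} \<and> Q (permute_list p xs).
      of_int (sign p) * prod_list (map var (permute_list p xs))) = (skew Q (set xs) :: 'a::comm_ring_1 ncpoly)"
proof -
  have "bij_betw (\<lambda>p. permute_list p xs) {p. p permutes {..<length xs} \<and> Q (permute_list p xs)}
      {w. w \<in> permutations_of_set (set xs) \<and> Q w}"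
    using bij_betw_Collect[OF bij_betw_permute_list[OF assms(1)], of Q "\<lambda>p. Q (permute_list p xs)"] by simp
  from sum.reindex_bij_betw[OF this, of "\<lambda>w. Poly_Mapping.single w (of_int (word_sign w) :: 'a)"]
  show ?thesis
    by (simp add: skew_def word_sign_permute_list assms prod_list_var of_int_mult_single)
qed

lemma alt_eq_skew:
  assumes "distinct xs" "sorted xs"
  shows "alt (map var xs) = (full_skew (set xs) :: 'a::comm_ring_1 ncpoly)"
proof -
  have "map (\<lambda>k. map var xs ! p k) [0..<length xs] = (map var (permute_list p xs) :: 'a ncpoly list)"
    if "p permutes {..<length xs}" for p
    using permutes_in_image[OF that] by (auto simp: permute_list_def)
  then show ?thesis
    using sum_permutes_eq_skew[OF assms, of "\<lambda>_. True", where 'a='a] unfolding alt_def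
    by simp
qed

text \<open>
  The Laplace expansion along the first letter, and in the next lemma the one along the last letter.
\<close>

lemma skew_first:
  assumes "finite A" "A \<noteq> {}"
  shows "full_skew A = (\<Sum>a\<in>A. (-1) ^ card {b \<in> A. b < a} * (var a * full_skew (A - {a})) :: 'a::comm_ring_1 ncpoly)"
proof -
  have "(\<Sum>a\<in>A. (-1) ^ card {b \<in> A. b < a} * (var a * full_skew (A - {a})) :: 'a ncpoly)
    = (\<Sum>a\<in>A. \<Sum>w\<in>permutations_of_set (A - {a}). Poly_Mapping.single (a # w) (of_int (word_sign (a # w))))"
  proof (rule sum.cong[OF refl])
    fix a assume "a \<in> A"
    have "of_int ((-1) ^ card {b \<in> A. b < a}) * (var a * Poly_Mapping.single w (of_int (word_sign w)))
        = (Poly_Mapping.single (a # w) (of_int (word_sign (a # w))) :: 'a ncpoly)"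
      if "w \<in> permutations_of_set (A - {a})" for w
    proof -
      have "{b. b < a} \<inter> set w = {b \<in> A. b < a}"
        using that by (auto simp: permutations_of_set_def)
      then have "length (filter (\<lambda>b. b < a) w) = card {b \<in> A. b < a}"
        using that by (simp add: permutations_of_set_def distinct_length_filter)
      then show ?thesis
        unfolding var_def single_mult_single of_int_mult_single by simp
    qed
    then show "(-1) ^ card {b \<in> A. b < a} * (var a * full_skew (A - {a}))
      = (\<Sum>w\<in>permutations_of_set (A - {a}). Poly_Mapping.single (a # w) (of_int (word_sign (a # w))) :: 'a ncpoly)"
      by (simp add: skew_def sum_distrib_left)
  qed
  also have "\<dots> = (\<Sum>(a, w)\<in>Sigma A (\<lambda>a. permutations_of_set (A - {a})). Poly_Mapping.single (a # w) (of_int (word_sign (a # w))))"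
    using assms by (intro sum.Sigma) auto
  also have "\<dots> = full_skew A" unfolding skew_def
  proof (rule sum.reindex_bij_witness[where i = "\<lambda>w. (hd w, tl w)" and j = "\<lambda>(a, w). a # w"])
    fix w assume w: "w \<in> {w \<in> permutations_of_set A. True}"
    then have "w \<noteq> []" using assms by (auto simp: permutations_of_set_def)
    then obtain a u where "w = a # u" by (cases w) auto
    then show "(case (hd w, tl w) of (a, w) \<Rightarrow> a # w) = w"
      "(hd w, tl w) \<in> (SIGMA a:A. permutations_of_set (A - {a}))"
      using w by (auto simp: permutations_of_set_def)
  next
    fix x assume "x \<in> (SIGMA a:A. permutations_of_set (A - {a}))"
    then obtain a w where x: "x = (a, w)" "a \<in> A" "set w = A - {a}" "distinct w"
      unfolding permutations_of_set_def by blast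
    then show "(case x of (a, w) \<Rightarrow> a # w) \<in> {w \<in> permutations_of_set A. True}"
      unfolding permutations_of_set_def by (simp add: insert_absorb)
    show "(hd (case x of (a, w) \<Rightarrow> a # w), tl (case x of (a, w) \<Rightarrow> a # w)) = x"
      using x(1) by simp
    show "Poly_Mapping.single (case x of (a, w) \<Rightarrow> a # w) (of_int (word_sign (case x of (a, w) \<Rightarrow> a # w)))
        = (case x of (a, w) \<Rightarrow> Poly_Mapping.single (a # w) (of_int (word_sign (a # w))))"
      using x(1) by simp
  qed
  finally show ?thesis by simp
qed

lemma skew_last:
  assumes "finite A" "A \<noteq> {}"
  shows "full_skew A = (\<Sum>a\<in>A. (-1) ^ card {b \<in> A. a < b} * (full_skew (A - {a}) * var a) :: 'a::comm_ring_1 ncpoly)"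
proof -
  have "(\<Sum>a\<in>A. (-1) ^ card {b \<in> A. a < b} * (full_skew (A - {a}) * var a) :: 'a ncpoly)
    = (\<Sum>a\<in>A. \<Sum>w\<in>permutations_of_set (A - {a}). Poly_Mapping.single (w @ [a]) (of_int (word_sign (w @ [a]))))"
  proof (rule sum.cong[OF refl])
    fix a assume "a \<in> A"
    have "of_int ((-1) ^ card {b \<in> A. a < b}) * (Poly_Mapping.single w (of_int (word_sign w)) * var a)
        = (Poly_Mapping.single (w @ [a]) (of_int (word_sign (w @ [a]))) :: 'a ncpoly)"
      if "w \<in> permutations_of_set (A - {a})" for w
    proof -
      have "{b. a < b} \<inter> set w = {b \<in> A. a < b}"
        using that by (auto simp: permutations_of_set_def)
      then have "length (filter (\<lambda>b. a < b) w) = card {b \<in> A. a < b}"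
        using that by (simp add: permutations_of_set_def distinct_length_filter)
      then show ?thesis
        unfolding var_def single_mult_single of_int_mult_single by (simp add: word_sign_snoc)
    qed
    then show "(-1) ^ card {b \<in> A. a < b} * (full_skew (A - {a}) * var a)
      = (\<Sum>w\<in>permutations_of_set (A - {a}). Poly_Mapping.single (w @ [a]) (of_int (word_sign (w @ [a]))) :: 'a ncpoly)"
      by (simp add: skew_def sum_distrib_left sum_distrib_right)
  qed
  also have "\<dots> = (\<Sum>(a, w)\<in>Sigma A (\<lambda>a. permutations_of_set (A - {a})). Poly_Mapping.single (w @ [a]) (of_int (word_sign (w @ [a]))))"
    using assms by (intro sum.Sigma) auto
  also have "\<dots> = full_skew A" unfolding skew_def
  proof (rule sum.reindex_bij_witness[where i = "\<lambda>w. (last w, butlast w)" and j = "\<lambda>(a, w). w @ [a]"])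
    fix w assume w: "w \<in> {w \<in> permutations_of_set A. True}"
    then have "w \<noteq> []" using assms by (auto simp: permutations_of_set_def)
    then obtain a u where "w = u @ [a]" by (cases w rule: rev_cases) auto
    then show "(case (last w, butlast w) of (a, w) \<Rightarrow> w @ [a]) = w"
      "(last w, butlast w) \<in> (SIGMA a:A. permutations_of_set (A - {a}))"
      using w by (auto simp: permutations_of_set_def)
  next
    fix x assume "x \<in> (SIGMA a:A. permutations_of_set (A - {a}))"
    then obtain a w where x: "x = (a, w)" "a \<in> A" "set w = A - {a}" "distinct w"
      unfolding permutations_of_set_def by blast
    then show "(case x of (a, w) \<Rightarrow> w @ [a]) \<in> {w \<in> permutations_of_set A. True}"
      unfolding permutations_of_set_def by (simp add: insert_absorb)
    show "(last (case x of (a, w) \<Rightarrow> w @ [a]), butlast (case x of (a, w) \<Rightarrow> w @ [a])) = x"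
      using x(1) by simp
    show "Poly_Mapping.single (case x of (a, w) \<Rightarrow> w @ [a]) (of_int (word_sign (case x of (a, w) \<Rightarrow> w @ [a])))
        = (case x of (a, w) \<Rightarrow> Poly_Mapping.single (w @ [a]) (of_int (word_sign (w @ [a]))))"
      using x(1) by simp
  qed
  finally show ?thesis by simp
qed

text \<open>
  Letter \<open>i\<close> has \<open>i - 1\<close> smaller and \<open>n + 1 - i\<close> greater companions. For even \<open>n\<close> these numbers have the
  same parity, so the two expansions of the full alternating sum agree in their signs and cancel.
\<close>

lemma alternating_commutator_sum:
  assumes "even n"
  shows "(\<Sum>i\<in>{1..n + 1}. (-1) ^ (i - 1) * (var i * full_skew ({1..n + 1} - {i}) - full_skew ({1..n + 1} - {i}) * var i))
    = (0 :: 'a::comm_ring_1 ncpoly)"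
proof -
  define X where "X = {1..n + 1}"
  have X: "finite X" "X \<noteq> {}" by (simp_all add: X_def)
  have signs: "(-1) ^ card {b \<in> X. b < i} = ((-1) ^ (i - 1) :: 'a ncpoly)"
    "(-1) ^ card {b \<in> X. i < b} = ((-1) ^ (i - 1) :: 'a ncpoly)" if i: "i \<in> X" for i
  proof -
    have "{b \<in> X. b < i} = {1..<i}" "{b \<in> X. i < b} = {i<..n + 1}"
      using i by (auto simp: X_def)
    moreover have "even (n + 1 - i) = even (i - 1)" using i assms by (auto simp: X_def)
    ultimately show "(-1) ^ card {b \<in> X. b < i} = ((-1) ^ (i - 1) :: 'a ncpoly)"
      "(-1) ^ card {b \<in> X. i < b} = ((-1) ^ (i - 1) :: 'a ncpoly)"
      by (simp_all add: minus_one_power_iff)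
  qed
  have "(\<Sum>i\<in>X. (-1) ^ (i - 1) * (var i * full_skew (X - {i}))) = (full_skew X :: 'a ncpoly)"
    unfolding skew_first[OF X] by (rule sum.cong[OF refl]) (simp add: signs)
  moreover have "(\<Sum>i\<in>X. (-1) ^ (i - 1) * (full_skew (X - {i}) * var i)) = (full_skew X :: 'a ncpoly)"
    unfolding skew_last[OF X] by (rule sum.cong[OF refl]) (simp add: signs)
  ultimately have "(\<Sum>i\<in>X. (-1) ^ (i - 1) * (var i * full_skew (X - {i}) - full_skew (X - {i}) * var i)) = (0 :: 'a ncpoly)"
    by (simp add: right_diff_distrib sum_subtractf)
  then show ?thesis by (simp only: X_def)
qed

lemma lookup_skew:
  "Poly_Mapping.lookup (skew Q A) w = (if w \<in> permutations_of_set A \<and> Q w then of_int (word_sign w) else 0)"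
  by (simp add: skew_def lookup_sum lookup_single when_def)

lemma decreasing_distinct: "sorted_wrt (>) (d :: nat list) \<Longrightarrow> distinct d"
  by (induction d) auto

lemma decreasing_word_greatest:
  assumes "sorted_wrt (>) d" "distinct w" "set w = set d" "w \<noteq> d"
  shows "deglex_less w d"
  using assms
proof (induction d arbitrary: w)
  case (Cons a d)
  have "length w = length (a # d)"
    using Cons.prems(2,3) decreasing_distinct[OF Cons.prems(1)] by (metis distinct_card)
  then obtain b v where w: "w = b # v" and len: "length v = length d" by (cases w) auto
  show ?case
  proof (cases "b = a")
    case True
    have "a \<notin> set d" "a \<notin> set v" using Cons.prems(1,2) True by (auto simp: w)
    moreover have "insert a (set v) = insert a (set d)" using Cons.prems(3) True by (simp add: w)
    ultimately have "set v = set d" by (metis Diff_insert_absorb)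
    then have "deglex_less v d"
      using Cons.prems True by (intro Cons.IH) (simp_all add: w)
    then show ?thesis using True by (simp add: w deglex_less_def Cons_lenlex_iff)
  next
    case False
    have "b \<in> set (a # d)" unfolding Cons.prems(3)[symmetric] by (simp add: w)
    then have "b < a" using Cons.prems(1) False by auto
    then show ?thesis using len by (simp add: w deglex_less_def Cons_lenlex_iff)
  qed
qed simp

lemma skew_split: "full_skew A = skew Q A + skew (\<lambda>w. \<not> Q w) A"
proof -
  have "{w. w \<in> permutations_of_set A} = {w. w \<in> permutations_of_set A \<and> Q w} \<union> {w. w \<in> permutations_of_set A \<and> \<not> Q w}"
    by blast
  then show ?thesis unfolding skew_def
    by (simp only: simp_thms) (subst sum.union_disjoint, auto)
qed

text \<open>
  Exchanging the adjacent letters \<open>a\<close> and \<open>b\<close> matches the words \<open>u b a v\<close> with the words \<open>u a b v\<close> of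
  opposite sign.
\<close>

lemma skew_adjacent:
  assumes "a \<noteq> b"
  shows "skew (adjacent_in a b) A = (\<Sum>(u, v) | u @ [b, a] @ v \<in> permutations_of_set A.
    Poly_Mapping.single u (of_int (word_sign (u @ [b, a] @ v)))
      * (var b * var a - var a * var b) * Poly_Mapping.single v (1 :: 'a::comm_ring_1))"
proof -
  let ?f = "\<lambda>w. Poly_Mapping.single w (of_int (word_sign w)) :: 'a ncpoly"
  let ?p = "\<lambda>c d. \<lambda>(u, v). u @ [c, d] @ v"
  let ?S = "{(u, v). u @ [b, a] @ v \<in> permutations_of_set A}"
  have inj: "inj_on (?p c d) ?S" if "{c, d} = {a, b}" for c d
  proof (rule inj_onI, clarify)
    fix u v u' v'
    assume "u @ [b, a] @ v \<in> permutations_of_set A" and eq: "u @ [c, d] @ v = u' @ [c, d] @ v'"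
    then have "c \<notin> set u" "c \<notin> set (d # v)"
      using that by (auto simp: permutations_of_set_def doubleton_eq_iff)
    with eq show "u = u' \<and> v = v'" using append_Cons_eq_iff[of c u "d # v" u' "d # v'"] by simp
  qed
  have D: "{w \<in> permutations_of_set A. sublist [b, a] w} = ?p b a ` ?S"
    "{w \<in> permutations_of_set A. sublist [a, b] w} = ?p a b ` ?S"
    by (force simp: sublist_def permutations_of_set_def)+
  have disj: "\<not> (sublist [b, a] w \<and> sublist [a, b] w)" if "w \<in> permutations_of_set A" for w
  proof
    assume "sublist [b, a] w \<and> sublist [a, b] w"
    then obtain u v u' v' where w: "w = u @ [b, a] @ v" and eq: "u @ [b, a] @ v = u' @ [a, b] @ v'"
      unfolding sublist_def by metis
    from that have "a \<notin> set (u @ [b])" "a \<notin> set v" "b \<notin> set v"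
      by (auto simp: permutations_of_set_def w)
    then show False
      using append_Cons_eq_iff[of a "u @ [b]" v u' "b # v'"] eq by simp
  qed
  have "{w. w \<in> permutations_of_set A \<and> adjacent_in a b w}
      = {w \<in> permutations_of_set A. sublist [b, a] w} \<union> {w \<in> permutations_of_set A. sublist [a, b] w}"
    by (auto simp: adjacent_in_def)
  then have "skew (adjacent_in a b) A = sum ?f (?p b a ` ?S) + sum ?f (?p a b ` ?S)"
    unfolding skew_def D[symmetric] using disj by (simp add: sum.union_disjoint disjoint_iff)
  also have "\<dots> = (\<Sum>x\<in>?S. ?f (?p b a x) + ?f (?p a b x))"
    using inj by (simp add: sum.reindex insert_commute sum.distrib)
  also have "\<dots> = (\<Sum>(u, v)\<in>?S. Poly_Mapping.single u (of_int (word_sign (u @ [b, a] @ v)))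
      * (var b * var a - var a * var b) * Poly_Mapping.single v 1)"
  proof (rule sum.cong[OF refl], clarify)
    fix u v
    have "word_sign (u @ a # b # v) = - word_sign (u @ b # a # v)"
      using word_sign_swap_adjacent assms by blast
    then show "?f (u @ [b, a] @ v) + ?f (u @ [a, b] @ v) = Poly_Mapping.single u (of_int (word_sign (u @ [b, a] @ v)))
      * (var b * var a - var a * var b) * Poly_Mapping.single v 1"
      by (simp add: var_def single_mult_single algebra_simps) (simp add: single_uminus)
  qed
  finally show ?thesis .
qed

section \<open>The basis elements and their leading words\<close>

lemma omit_props:
  assumes "1 \<le> i" "i \<le> n + 1"
  shows "set (omit n i) = {1..n + 1} - {i}" "distinct (omit n i)" "sorted (omit n i)" "length (omit n i) = n"
proof -
  show s: "set (omit n i) = {1..n + 1} - {i}" by (auto simp: omit_def)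
  show d: "distinct (omit n i)" by (simp add: omit_def)
  show "sorted (omit n i)" unfolding omit_def by (rule sorted_wrt_filter) (rule sorted_upt)
  show "length (omit n i) = n"
    using distinct_card[OF d] assms by (simp add: s)
qed

abbreviation lead :: "nat \<Rightarrow> nat \<Rightarrow> nat list" where
  "lead n i \<equiv> rev (omit n i)"

lemma lead_decreasing: "sorted_wrt (>) (lead n i)"
proof -
  have "sorted_wrt (<) (omit n i)"
    unfolding omit_def by (rule sorted_wrt_filter) (rule sorted_wrt_upt)
  then show ?thesis by (simp add: sorted_wrt_rev)
qed

lemma G_eq:
  assumes "1 \<le> i" "i \<le> n + 1"
  shows "G n i = ((-1) ^ (n div 2) * (full_skew ({1..n + 1} - {i}) - (if i = n + 1 then var 1 else 0)) :: 'a::comm_ring_1 ncpoly)"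
  using assms by (simp only: G_def alt_eq_skew omit_props)

lemma H_eq:
  assumes "1 \<le> i" "i \<le> n + 1"
  shows "H n i = ((-1) ^ (n div 2) * skew (\<lambda>w. \<not> adjacent_in 1 (n + 1) w) ({1..n + 1} - {i}) :: 'a::comm_ring_1 ncpoly)"
proof -
  have a: "arrangement n i p = permute_list p (omit n i)" for p
    by (simp only: arrangement_def permute_list_def omit_props(4)[OF assms])
  show ?thesis
    using sum_permutes_eq_skew[OF omit_props(2,3)[OF assms], of "\<lambda>w. \<not> adjacent_in 1 (n + 1) w", where 'a='a]
    unfolding H_def T_def a omit_props(1,4)[OF assms] by (simp only:)
qed

lemma G_eq_H_plus_N_multiples:
  assumes "2 \<le> i" "i \<le> n"
  shows "G n i = (H n i + (-1) ^ (n div 2) * (\<Sum>(u, v) | u @ [n + 1, 1] @ v \<in> permutations_of_set ({1..n + 1} - {i}).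
    Poly_Mapping.single u (of_int (word_sign (u @ [n + 1, 1] @ v))) * N n * Poly_Mapping.single v 1) :: 'a::comm_ring_1 ncpoly)"
proof -
  have i: "1 \<le> i" "i \<le> n + 1" "i \<noteq> n + 1" "1 \<noteq> n + 1" using assms by simp_all
  show ?thesis
    unfolding G_eq[OF i(1,2)] H_eq[OF i(1,2)] N_def skew_adjacent[OF i(4), symmetric]
    using i(3) skew_split[of "{1..n + 1} - {i}" "\<lambda>w. \<not> adjacent_in 1 (n + 1) w", where 'a='a]
    by (simp add: distrib_left)
qed

lemma lookup_sign_mult:
  "Poly_Mapping.lookup ((-1) ^ m * f) w = (-1) ^ m * Poly_Mapping.lookup (f :: 'a::comm_ring_1 ncpoly) w"
  by (cases "even m") simp_all

lemma monic_skew: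
  assumes d: "sorted_wrt (>) d" "set d = A" and "Q d"
  shows "monic_at ((-1) ^ (length d div 2) * skew Q A :: 'a::comm_ring_1 ncpoly) d"
  unfolding monic_at_def
proof (intro conjI ballI impI)
  have "d \<in> permutations_of_set A"
    using d decreasing_distinct[OF d(1)] by blast
  then show "Poly_Mapping.lookup ((-1) ^ (length d div 2) * skew Q A :: 'a ncpoly) d = 1"
    using assms(3) by (simp add: lookup_sign_mult lookup_skew word_sign_decreasing d(1) flip: power_add mult_2)
next
  fix k assume "k \<in> Poly_Mapping.keys ((-1) ^ (length d div 2) * skew Q A :: 'a ncpoly)" and ne: "k \<noteq> d"
  then have "k \<in> permutations_of_set A"
    by (simp add: in_keys_iff lookup_sign_mult lookup_skew split: if_splits)
  then show "deglex_less k d"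
    using decreasing_word_greatest[OF d(1)] ne d(2) by (simp add: permutations_of_set_def)
qed

lemma monic_at_diff:
  fixes f h :: "'a::comm_ring_1 ncpoly"
  assumes f: "monic_at f l" and h: "\<And>k. k \<in> Poly_Mapping.keys h \<Longrightarrow> deglex_less k l"
  shows "monic_at (f - h) l"
  unfolding monic_at_def
proof (intro conjI ballI impI)
  have "Poly_Mapping.lookup h l = 0"
    using h[of l] deglex_irrefl[of l] unfolding in_keys_iff by blast
  then show "Poly_Mapping.lookup (f - h) l = 1"
    using f by (simp add: lookup_minus monic_at_def)
next
  fix k assume "k \<in> Poly_Mapping.keys (f - h)" "k \<noteq> l"
  moreover from this(1) have "k \<in> Poly_Mapping.keys f \<or> k \<in> Poly_Mapping.keys h"
    by (simp add: in_keys_iff lookup_minus) (metis diff_zero)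
  ultimately show "deglex_less k l"
    using f h[of k] unfolding monic_at_def by metis
qed

lemma monic_G_first:
  assumes "1 \<le> n"
  shows "monic_at (G n 1 :: 'a::comm_ring_1 ncpoly) (lead n 1)"
  using monic_skew[OF lead_decreasing, of n 1 "{1..n + 1} - {1}" "\<lambda>_. True", where 'a='a] assms
    omit_props[of 1 n] G_eq[of 1 n, where 'a='a] by simp

lemma monic_G_last:
  assumes "2 \<le> n"
  shows "monic_at (G n (n + 1) :: 'a::comm_ring_1 ncpoly) (lead n (n + 1))"
proof -
  have o: "set (lead n (n + 1)) = {1..n + 1} - {n + 1}" "length (lead n (n + 1)) = n"
    using omit_props[of "n + 1" n] by (simp_all only: set_rev length_rev)
  have m: "monic_at ((-1) ^ (n div 2) * full_skew ({1..n + 1} - {n + 1}) :: 'a ncpoly) (lead n (n + 1))"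
    using monic_skew[OF lead_decreasing o(1), of "\<lambda>_. True", where 'a='a] by (simp only: o(2))
  have G: "G n (n + 1) = ((-1) ^ (n div 2) * full_skew ({1..n + 1} - {n + 1}) - (-1) ^ (n div 2) * var 1 :: 'a ncpoly)"
    using G_eq[of "n + 1" n, where 'a='a] by (simp add: right_diff_distrib)
  show ?thesis unfolding G
  proof (rule monic_at_diff[OF m])
    fix k assume "k \<in> Poly_Mapping.keys ((-1) ^ (n div 2) * var 1 :: 'a ncpoly)"
    then have "k = [1]"
      by (simp add: in_keys_iff lookup_sign_mult var_def lookup_single when_def split: if_splits)
    then show "deglex_less k (lead n (n + 1))"
      using assms o(2) by (simp add: deglex_less_def lenlex_conv)
  qed
qed

text \<open>
  In the decreasing word, \<open>n + 1\<close> comes first and \<open>1\<close> last. If they were adjacent, the word would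
  have only these two letters.
\<close>

lemma monic_H:
  assumes "2 \<le> i" "i \<le> n" "4 \<le> n"
  shows "monic_at (H n i :: 'a::comm_ring_1 ncpoly) (lead n i)"
proof -
  have i: "1 \<le> i" "i \<le> n + 1" using assms by simp_all
  have o: "set (lead n i) = {1..n + 1} - {i}" "length (lead n i) = n"
    using omit_props[OF i] by (simp_all only: set_rev length_rev)
  have "\<not> adjacent_in 1 (n + 1) (lead n i)"
  proof
    assume "adjacent_in 1 (n + 1) (lead n i)"
    then obtain u v where "lead n i = u @ [1, n + 1] @ v \<or> lead n i = u @ [n + 1, 1] @ v"
      unfolding adjacent_in_def sublist_def by metis
    moreover have "lead n i \<noteq> u @ [1, n + 1] @ v"
      using lead_decreasing[of n i] assms by (auto simp: sorted_wrt_append)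
    ultimately have w: "lead n i = u @ [n + 1, 1] @ v" by blast
    have out: "\<forall>x\<in>set u. x > n + 1" "\<forall>x\<in>set v. x < 1"
      using lead_decreasing[of n i] unfolding w by (simp_all add: sorted_wrt_append)
    have "x \<in> {1..n + 1}" if "x \<in> set u \<or> x \<in> set v" for x
    proof -
      have "x \<in> set (lead n i)" unfolding w using that by auto
      then show ?thesis unfolding o(1) by simp
    qed
    with out have "u = []" "v = []"
      by (metis atLeastAtMost_iff leD list.set_sel(1))+
    then show False using o(2) assms(3) unfolding w by simp
  qed
  with monic_skew[OF lead_decreasing o(1), of "\<lambda>w. \<not> adjacent_in 1 (n + 1) w", where 'a='a]
  show ?thesis unfolding H_eq[OF i] o(2) by blast
qed

lemma monic_N:
  assumes "1 \<le> n"
  shows "monic_at (N n :: 'a::comm_ring_1 ncpoly) [n + 1, 1]"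
proof -
  have "N n = (Poly_Mapping.single [n + 1, 1] 1 - Poly_Mapping.single [1, n + 1] 1 :: 'a ncpoly)"
    by (simp add: N_def var_def single_mult_single)
  moreover have "monic_at (Poly_Mapping.single [n + 1, 1] 1 :: 'a ncpoly) [n + 1, 1]"
    by (simp add: monic_at_def)
  moreover have "deglex_less [1, n + 1] [n + 1, 1]"
    using assms by (simp add: deglex_less_def Cons_lenlex_iff)
  ultimately show ?thesis
    using monic_at_diff[of "Poly_Mapping.single [n + 1, 1] (1::'a)" "[n + 1, 1]" "Poly_Mapping.single [1, n + 1] 1"]
    by simp
qed

definition rules :: "nat \<Rightarrow> (nat list \<times> 'a::comm_ring_1 ncpoly) set" where
  "rules n = {(lead n 1, G n 1), (lead n (n + 1), G n (n + 1)), ([n + 1, 1], N n)}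
     \<union> (\<lambda>i. (lead n i, H n i)) ` {2..n}"

lemma rules_monic:
  assumes "4 \<le> n" "(l, g) \<in> (rules n :: (nat list \<times> 'a::comm_ring_1 ncpoly) set)"
  shows "monic_at g l"
proof -
  from assms(2) consider "l = lead n 1" "g = G n 1" | "l = lead n (n + 1)" "g = G n (n + 1)"
    | "l = [n + 1, 1]" "g = N n" | i where "2 \<le> i" "i \<le> n" "l = lead n i" "g = H n i"
    unfolding rules_def by auto
  then show ?thesis
    using assms(1) monic_G_first[of n] monic_G_last[of n] monic_N[of n] monic_H[of _ n] by cases simp_all
qed

section \<open>The syzygy of the generators\<close>

text \<open>
  The commutators with the alternating sums cancel. What remains is the commutator of \<open>x\<^bsub>n+1\<^esub>\<close> with the
  linear term \<open>x\<^sub>1\<close> of \<open>G\<^bsub>n+1\<^esub>\<close>.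
\<close>

lemma signed_commutator_sum:
  assumes "even n"
  shows "(\<Sum>i\<in>{1..n + 1}. (-1) ^ (i - 1) * (var i * G n i - G n i * var i))
    = (- ((-1) ^ (n div 2) * N n) :: 'a::comm_ring_1 ncpoly)"
proof -
  define \<epsilon> where "\<epsilon> = ((-1) ^ (n div 2) :: 'a ncpoly)"
  define X where "X = {1..n + 1}"
  have central: "f * \<epsilon> = \<epsilon> * f" for f
    unfolding \<epsilon>_def by (cases "even (n div 2)") simp_all
  have comm: "(-1) ^ (i - 1) * (var i * G n i - G n i * var i)
      = \<epsilon> * ((-1) ^ (i - 1) * (var i * full_skew (X - {i}) - full_skew (X - {i}) * var i))
        - (if i = n + 1 then \<epsilon> * N n else 0)"
    if "i \<in> X" for i
  proof -
    define s where "s = ((-1) ^ (i - 1) :: 'a ncpoly)"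
    have s: "f * s = s * f" for f
      unfolding s_def by (cases "even (i - 1)") simp_all
    have l: "var i * (\<epsilon> * f) = \<epsilon> * (var i * f)" for f
      by (metis central mult.assoc)
    have l': "s * (\<epsilon> * f) = \<epsilon> * (s * f)" for f
      by (metis central mult.assoc)
    have g: "G n i = \<epsilon> * (full_skew (X - {i}) - (if i = n + 1 then var 1 else 0))"
      using G_eq[of i n, where 'a='a] that by (simp only: X_def \<epsilon>_def atLeastAtMost_iff)
    show ?thesis
    proof (cases "i = n + 1")
      case True
      have "s = 1" using assms True by (simp add: s_def)
      then show ?thesis
        unfolding g s_def[symmetric] l mult.assoc using True
        by (simp add: N_def algebra_simps)
    next
      case False
      then show ?thesis
        unfolding g s_def[symmetric] l mult.assoc by (simp add: right_diff_distrib[symmetric] l')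
    qed
  qed
  have "(\<Sum>i\<in>X. (-1) ^ (i - 1) * (var i * G n i - G n i * var i))
      = \<epsilon> * (\<Sum>i\<in>X. (-1) ^ (i - 1) * (var i * full_skew (X - {i}) - full_skew (X - {i}) * var i))
        - (\<Sum>i\<in>X. if i = n + 1 then \<epsilon> * N n else 0)"
    unfolding sum_distrib_left sum_subtractf[symmetric] by (rule sum.cong[OF refl comm])
  also have "\<dots> = - (\<epsilon> * N n)"
    unfolding X_def alternating_commutator_sum[OF assms] by (simp add: sum.delta)
  finally show ?thesis by (simp only: X_def \<epsilon>_def)
qed

lemma combos_sign: "f \<in> combos R P \<Longrightarrow> (-1) ^ m * f \<in> combos R P"
  by (cases "even m") (simp_all add: combos_uminus)

text \<open>
  The generators that are not in the basis satisfy the same bound as if they were: every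
  multiple of \<open>H\<^sub>i\<close> or \<open>N\<close> that occurs in \<open>G\<^sub>i\<close> has an arrangement of the letters of \<open>G\<^sub>i\<close> as leading word.
\<close>

lemma G_middle_combos:
  assumes i: "2 \<le> i" "i \<le> n" and P: "\<And>w. w \<in> permutations_of_set ({1..n + 1} - {i}) \<Longrightarrow> P (a @ w @ b)"
  shows "Poly_Mapping.single a 1 * G n i * Poly_Mapping.single b 1 \<in> combos (rules n :: (nat list \<times> 'a::comm_ring_1 ncpoly) set) P"
proof -
  define Q where "Q w \<longleftrightarrow> w \<in> permutations_of_set ({1..n + 1} - {i})" for w
  have "(lead n i, H n i) \<in> rules n"
    using i by (simp add: rules_def)
  moreover have "Q ([] @ lead n i @ [])"
    using omit_props[of i n] i by (simp add: Q_def permutations_of_set_def)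
  ultimately have H: "Poly_Mapping.single [] 1 * H n i * Poly_Mapping.single [] 1 \<in> combos (rules n :: (nat list \<times> 'a ncpoly) set) Q"
    by (rule combos_term)
  have N: "([n + 1, 1], N n) \<in> (rules n :: (nat list \<times> 'a ncpoly) set)"
    by (simp add: rules_def)
  have "(\<Sum>(u, v) | u @ [n + 1, 1] @ v \<in> permutations_of_set ({1..n + 1} - {i}).
      Poly_Mapping.single u (of_int (word_sign (u @ [n + 1, 1] @ v))) * N n * Poly_Mapping.single v 1)
    \<in> combos (rules n :: (nat list \<times> 'a ncpoly) set) Q"
  proof (rule combos_sum)
    fix x assume "x \<in> {(u, v). u @ [n + 1, 1] @ v \<in> permutations_of_set ({1..n + 1} - {i})}"
    then obtain u v where x: "x = (u, v)" and "Q (u @ [n + 1, 1] @ v)"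
      unfolding Q_def by blast
    from combos_term[where P = Q and u = u and v = v, OF N this(2)]
    show "(case x of (u, v) \<Rightarrow> Poly_Mapping.single u (of_int (word_sign (u @ [n + 1, 1] @ v))) * N n * Poly_Mapping.single v 1)
      \<in> combos (rules n :: (nat list \<times> 'a ncpoly) set) Q"
      unfolding x by simp
  qed
  from combos_add[OF H combos_sign[OF this]]
  have "G n i \<in> combos (rules n :: (nat list \<times> 'a ncpoly) set) Q"
    unfolding G_eq_H_plus_N_multiples[OF i] by simp
  then show ?thesis
    by (rule combos_mult) (simp add: P Q_def)
qed

text \<open>
  Solving \<open>signed_commutator_sum\<close> for the composition leaves \<open>N\<close>, which is short, and multiples of the
  generators whose leading words are arrangements of all letters. The decreasing
  arrangement starts with \<open>n + 1\<close> and ends with \<open>1\<close>; each of the remaining multiples \<open>x\<^sub>i G\<^sub>i\<close> has \<open>i \<le> n\<close>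
  and each \<open>G\<^sub>i x\<^sub>i\<close> has \<open>i \<ge> 2\<close>, so none of them attains it.
\<close>

lemma overlap_resolves:
  assumes "4 \<le> n" "even n"
  shows "G n 1 * var 1 - var (n + 1) * G n (n + 1)
    \<in> combos (rules n :: (nat list \<times> 'a::comm_ring_1 ncpoly) set) (\<lambda>z. deglex_less z (rev [1..<n + 2]))"
proof -
  let ?w = "rev [1..<n + 2]"
  let ?C = "combos (rules n :: (nat list \<times> 'a ncpoly) set) (\<lambda>z. deglex_less z ?w)"
  have less: "deglex_less w ?w" if "distinct w" "set w = {1..n + 1}" "hd w \<noteq> n + 1 \<or> last w \<noteq> 1" for w
  proof (rule decreasing_word_greatest)
    show "sorted_wrt (>) ?w" by (simp add: sorted_wrt_rev del: upt_Suc)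
    show "distinct w" by fact
    show "set w = set ?w" unfolding that(2) by auto
    have "hd ?w = n + 1" "last ?w = 1"
      by (simp, simp only: last_rev, simp add: upt_conv_Cons del: upt_Suc)
    then show "w \<noteq> ?w" using that(3) by metis
  qed
  have first: "deglex_less ([i] @ w @ []) ?w" if "w \<in> permutations_of_set ({1..n + 1} - {i})" "i \<in> {1..n}" for w i
  proof (rule less)
    show "set ([i] @ w @ []) = {1..n + 1}"
      using that(2) permutations_of_setD(1)[OF that(1)] by (simp add: insert_absorb)
  qed (use that(2) permutations_of_setD[OF that(1)] in simp_all)
  have last: "deglex_less ([] @ w @ [i]) ?w" if "w \<in> permutations_of_set ({1..n + 1} - {i})" "i \<in> {2..n + 1}" for w i
  proof (rule less)
    show "set ([] @ w @ [i]) = {1..n + 1}"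
      using that(2) permutations_of_setD(1)[OF that(1)] by (simp add: insert_absorb)
  qed (use that(2) permutations_of_setD[OF that(1)] in simp_all)
  have lead_in: "lead n i \<in> permutations_of_set ({1..n + 1} - {i})" if "i \<in> {1..n + 1}" for i
    using omit_props[of i n] that by (simp add: permutations_of_set_def)
  have single_var: "var i = (Poly_Mapping.single [i] 1 :: 'a ncpoly)" for i by (simp only: var_def)
  have t1: "Poly_Mapping.single [1] 1 * G n 1 * Poly_Mapping.single [] 1 \<in> ?C"
  proof (rule combos_term)
    show "(lead n 1, G n 1) \<in> (rules n :: (nat list \<times> 'a ncpoly) set)" by (simp add: rules_def)
    show "deglex_less ([1] @ lead n 1 @ []) ?w" using assms by (intro first lead_in) simp_all
  qed
  have t2: "Poly_Mapping.single [] 1 * G n (n + 1) * Poly_Mapping.single [n + 1] 1 \<in> ?C"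
  proof (rule combos_term)
    show "(lead n (n + 1), G n (n + 1)) \<in> (rules n :: (nat list \<times> 'a ncpoly) set)" by (simp add: rules_def)
    show "deglex_less ([] @ lead n (n + 1) @ [n + 1]) ?w" using assms by (intro last lead_in) simp_all
  qed
  have t3: "Poly_Mapping.single [] 1 * N n * Poly_Mapping.single [] 1 \<in> ?C"
  proof (rule combos_term)
    show "([n + 1, 1], N n) \<in> (rules n :: (nat list \<times> 'a ncpoly) set)" by (simp add: rules_def)
    show "deglex_less ([] @ [n + 1, 1] @ []) ?w" using assms by (simp add: deglex_less_def lenlex_conv del: upt_Suc)
  qed
  have mid: "(-1) ^ (i - 1) * (var i * G n i - G n i * var i) \<in> ?C" if "i \<in> {2..n}" for i
  proof -
    have "Poly_Mapping.single [i] 1 * G n i * Poly_Mapping.single [] 1 \<in> ?C"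
      using that by (intro G_middle_combos first) simp_all
    moreover have "Poly_Mapping.single [] 1 * G n i * Poly_Mapping.single [i] 1 \<in> ?C"
      using that by (intro G_middle_combos last) simp_all
    ultimately show ?thesis
      by (intro combos_sign combos_diff) (simp_all add: single_var)
  qed
  define c where "c i = ((-1) ^ (i - 1) * (var i * G n i - G n i * var i) :: 'a ncpoly)" for i
  define M where "M = sum c {2..n}"
  have "{1..n + 1} = insert 1 (insert (n + 1) {2..n})" using assms by auto
  moreover have "sum c (insert 1 (insert (n + 1) {2..n})) = c 1 + (c (n + 1) + M)"
    using assms(1) unfolding M_def by simp
  moreover have "c 1 = var 1 * G n 1 - G n 1 * var 1"
    "c (n + 1) = var (n + 1) * G n (n + 1) - G n (n + 1) * var (n + 1)"
    using assms(2) by (simp_all add: c_def)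
  moreover have "sum c {1..n + 1} = - ((-1) ^ (n div 2) * N n)"
    unfolding c_def by (rule signed_commutator_sum[OF assms(2)])
  ultimately have sum: "(var 1 * G n 1 - G n 1 * var 1)
      + ((var (n + 1) * G n (n + 1) - G n (n + 1) * var (n + 1)) + M) = - ((-1) ^ (n div 2) * N n)"
    by (simp only:)
  have "G n 1 * var 1 - var (n + 1) * G n (n + 1)
    = var 1 * G n 1 - G n (n + 1) * var (n + 1) + M
      - ((var 1 * G n 1 - G n 1 * var 1)
      + ((var (n + 1) * G n (n + 1) - G n (n + 1) * var (n + 1)) + M))"
    by (simp only: algebra_simps)
  also have "\<dots> = var 1 * G n 1 - G n (n + 1) * var (n + 1) + M + (-1) ^ (n div 2) * N n"
    unfolding sum by simp
  also have "\<dots> \<in> ?C"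
  proof (intro combos_add combos_diff combos_sign)
    show "M \<in> ?C" unfolding M_def c_def by (intro combos_sum mid)
  qed (use t1 t2 t3 in \<open>simp_all add: single_var\<close>)
  finally show ?thesis .
qed

section \<open>The only overlap of leading words\<close>

lemma lead_first: "1 \<le> n \<Longrightarrow> lead n 1 = (n + 1) # rev [2..<n + 1]"
proof -
  assume "1 \<le> n"
  then have "[2..<n + 2] = [2..<n + 1] @ [n + 1]"
    using upt_Suc_append[of 2 "n + 1"] by simp
  moreover have "[1..<n + 2] = 1 # [2..<n + 2]"
    using upt_conv_Cons[of 1 "n + 2"] by (simp add: numeral_2_eq_2 del: upt_Suc)
  moreover have "filter (\<lambda>j. j \<noteq> 1) [2..<n + 2] = [2..<n + 2]"
    by (rule filter_True) auto
  ultimately show ?thesis unfolding omit_def by simp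
qed

lemma lead_first_append: "1 \<le> n \<Longrightarrow> lead n 1 @ [1] = rev [1..<n + 2]"
proof -
  assume n: "1 \<le> n"
  then have "[1..<n + 2] = (1 # [2..<n + 1]) @ [n + 1]"
    using upt_Suc_append[of 1 "n + 1"] upt_conv_Cons[of 1 "n + 1"]
    by (simp add: numeral_2_eq_2 del: upt_Suc)
  then show ?thesis unfolding lead_first[OF n] by simp
qed

lemma lead_last: "lead n (n + 1) = rev [1..<n + 1]"
  by (auto simp: omit_def filter_id_conv)

lemma rules_cases:
  assumes "(l, g) \<in> rules n"
  obtains (lead) i where "i \<in> {1..n + 1}" "l = lead n i" "g = (if i \<in> {2..n} then H n i else G n i)"
    | (commutator) "l = [n + 1, 1]" "g = N n"
proof -
  from assms consider "l = lead n 1" "g = G n 1" | "l = lead n (n + 1)" "g = G n (n + 1)"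
    | "l = [n + 1, 1]" "g = N n" | i where "2 \<le> i" "i \<le> n" "l = lead n i" "g = H n i"
    unfolding rules_def by auto
  then show thesis
  proof cases
    case 1
    then show ?thesis by (intro lead[of 1]) simp_all
  next
    case 2
    then show ?thesis by (intro lead[of "n + 1"]) simp_all
  next
    case 3
    then show ?thesis by (rule commutator)
  next
    case (4 i)
    then show ?thesis by (intro lead[of i]) simp_all
  qed
qed

lemma lead_set: "i \<in> {1..n + 1} \<Longrightarrow> set (lead n i) = {1..n + 1} - {i}"
  and lead_length: "i \<in> {1..n + 1} \<Longrightarrow> length (lead n i) = n"
  using omit_props[of i n] by simp_all

lemma lead_not_commutator:
  assumes "4 \<le> n" "i \<in> {1..n + 1}"
  shows "lead n i \<noteq> [n + 1, 1] @ v"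
proof
  assume w: "lead n i = [n + 1, 1] @ v"
  then have "v \<noteq> []" using lead_length[OF assms(2)] assms(1) by auto
  then obtain x v' where v: "v = x # v'" by (cases v) auto
  then have "x < 1" "x \<in> {1..n + 1}"
    using lead_decreasing[of n i] lead_set[OF assms(2)] unfolding w by auto
  then show False by simp
qed

text \<open>
  Two leading words at the same position coincide: those of length \<open>n\<close> have equal length, and none of
  them can continue the word \<open>x\<^bsub>n+1\<^esub> x\<^sub>1\<close>, since no letter is smaller than \<open>1\<close>. If the second leading word
  starts later, inside the first one, then its first letter is at most \<open>n\<close>, because the first word is
  decreasing. So it is \<open>x\<^sub>n \<dots> x\<^sub>1\<close>, and only one letter, \<open>n + 1\<close>, fits in front of it. The first word
  then continues with \<open>n\<close>, so it is not that of \<open>N\<close>; having \<open>n\<close> letters, it continues with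
  \<open>x\<^sub>n \<dots> x\<^sub>2\<close>, which identifies it as the leading word of \<open>G\<^sub>1\<close>.
\<close>

lemma rules_overlap_cases:
  assumes n: "4 \<le> n"
    and r: "(l, g) \<in> rules n" "(l', g') \<in> rules n"
    and eq: "l @ v = u @ l' @ v'" and len: "length u < length l"
  shows "u = [] \<and> g = g' \<and> v = v' \<or>
    l = lead n 1 \<and> g = G n 1 \<and> g' = G n (n + 1) \<and> u = [n + 1] \<and> v = 1 # v'"
proof (cases "u = []")
  case True
  with eq have eq: "l @ v = l' @ v'" by simp
  have no: False if "lead n i @ v = [n + 1, 1] @ v'" "i \<in> {1..n + 1}" for i v v'
  proof -
    have "length [n + 1, 1] \<le> length (lead n i)" using lead_length[OF that(2)] n by simp
    from append_eq_split[OF that(1)[symmetric] this] lead_not_commutator[OF n that(2)] show False by metis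
  qed
  from r(1) show ?thesis
  proof (cases rule: rules_cases)
    case l: (lead i)
    from r(2) show ?thesis
    proof (cases rule: rules_cases)
      case l': (lead j)
      have "lead n i = lead n j" "v = v'"
        using eq lead_length[OF l(1)] lead_length[OF l'(1)] unfolding l l' by simp_all
      moreover from this(1) have "{1..n + 1} - {i} = {1..n + 1} - {j}"
        using lead_set[OF l(1)] lead_set[OF l'(1)] by simp
      then have "i = j" using l(1) l'(1) by blast
      ultimately show ?thesis using True l l' by simp
    next
      case commutator
      then show ?thesis using no[of i v v'] l(1) eq unfolding l(2) by simp
    qed
  next
    case c: commutator
    from r(2) show ?thesis
    proof (cases rule: rules_cases)
      case (lead j)
      then show ?thesis using no[of j v' v] eq unfolding c(1) by simp
    next
      case commutator
      then show ?thesis using True eq c by simp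
    qed
  qed
next
  case False
  from append_eq_split[of u "l' @ v'" l v] eq len obtain m where l: "l = u @ m" and m: "l' @ v' = m @ v" by auto
  have "m \<noteq> []" using l len by auto
  have dec: "sorted_wrt (>) l" "set l \<subseteq> {1..n + 1}" "length l \<le> n"
    using r(1) n lead_decreasing[of n] lead_set[of _ n] lead_length[of _ n] by (cases rule: rules_cases; auto)+
  have "l' \<noteq> []" using r(2) n lead_length[of _ n] by (cases rule: rules_cases) force+
  then have hd: "hd l' = hd m" using m \<open>m \<noteq> []\<close> by (metis hd_append2)
  have small: "hd m < x" if "x \<in> set u" for x
    using dec(1) that hd_in_set[OF \<open>m \<noteq> []\<close>] unfolding l sorted_wrt_append by simp
  then have "hd m < n + 1"
    using small[OF hd_in_set[OF False]] subsetD[OF dec(2), of "hd u"] hd_in_set[OF False]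
    unfolding l set_append by fastforce
  have hd_max: "n + 1 \<notin> set l'"
  proof
    assume "n + 1 \<in> set l'"
    moreover have "sorted_wrt (>) l'"
      using r(2) n lead_decreasing[of n] by (cases rule: rules_cases) auto
    ultimately have "n + 1 \<le> hd l'" by (cases l') auto
    then show False using hd \<open>hd m < n + 1\<close> by simp
  qed
  have l': "l' = lead n (n + 1)" "g' = G n (n + 1)"
    using r(2) hd_max lead_set[of _ n] by (cases rule: rules_cases; force split: if_splits)+
  have "hd m = n"
    using hd n unfolding l'(1) lead_last by simp
  have "set u \<subseteq> {n + 1}"
    using small dec(2) unfolding l \<open>hd m = n\<close> by fastforce
  moreover have "distinct u" using decreasing_distinct[OF dec(1)] unfolding l by simp
  ultimately have u: "u = [n + 1]"
    using False by (cases u; cases "tl u") auto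
  from r(1) obtain i where i: "i \<in> {1..n + 1}" "l = lead n i" "g = (if i \<in> {2..n} then H n i else G n i)"
  proof (cases rule: rules_cases)
    case commutator
    then have "hd m = 1" using l u by simp
    then show ?thesis using \<open>hd m = n\<close> n by simp
  qed
  have "length m = n - 1" using lead_length[OF i(1)] l u i(2) by simp
  have "rev [1..<n + 1] = rev [2..<n + 1] @ [1]"
    using n upt_conv_Cons[of 1 "n + 1"] by (simp add: numeral_2_eq_2 del: upt_Suc)
  then have m: "rev [2..<n + 1] @ 1 # v' = m @ v"
    using m unfolding l'(1) lead_last by simp
  moreover have "length (rev [2..<n + 1]) = length m" using \<open>length m = n - 1\<close> n by simp
  ultimately have mv: "m = rev [2..<n + 1]" "v = 1 # v'" by simp_all
  then have l1: "l = lead n 1"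
    using l u lead_first[of n] n by simp
  then have "{1..n + 1} - {i} = {1..n + 1} - {1}"
    using i lead_set[of i n] lead_set[of 1 n] n by simp
  moreover have "1 \<in> {1..n + 1}" by simp
  ultimately have "i = 1" using i(1) by blast
  then show ?thesis using i(3) l1 l' u mv by simp
qed

section \<open>The ideal of the generators\<close>

lemma free_algebra_simps:
  "carrier (free_algebra X) = {f :: 'a::ring_1 ncpoly. Poly_Mapping.keys f \<subseteq> lists X}"
  "f \<otimes>\<^bsub>free_algebra X\<^esub> h = f * (h :: 'a ncpoly)"
  "f \<oplus>\<^bsub>free_algebra X\<^esub> h = f + h" "\<zero>\<^bsub>free_algebra X\<^esub> = (0 :: 'a ncpoly)"
  by (simp_all add: free_algebra_def)

lemma a_inv_free_algebra:
  assumes "(f :: 'a::ring_1 ncpoly) \<in> carrier (free_algebra X)"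
  shows "\<ominus>\<^bsub>free_algebra X\<^esub> f = - f"
proof -
  interpret ring "free_algebra X :: 'a ncpoly ring" by (rule ring_free_algebra)
  show ?thesis
    by (rule minus_equality) (use assms in \<open>simp_all add: free_algebra_simps\<close>)
qed

lemma combos_mult_poly_left:
  assumes "f \<in> combos R (\<lambda>_. True)"
  shows "h * f \<in> combos R (\<lambda>_. True)"
proof -
  have "(\<Sum>k\<in>Poly_Mapping.keys h. Poly_Mapping.single k (Poly_Mapping.lookup h k) * f * Poly_Mapping.single [] 1)
      \<in> combos R (\<lambda>_. True)"
    by (intro combos_sum combos_mult[OF assms]) simp
  also have "(\<Sum>k\<in>Poly_Mapping.keys h. Poly_Mapping.single k (Poly_Mapping.lookup h k) * f * Poly_Mapping.single [] 1) = h * f"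
    by (simp add: sum_single_lookup flip: sum_distrib_right)
  finally show ?thesis .
qed

lemma combos_mult_poly_right:
  assumes "f \<in> combos R (\<lambda>_. True)"
  shows "f * h \<in> combos R (\<lambda>_. True)"
proof -
  have "(\<Sum>k\<in>Poly_Mapping.keys h. Poly_Mapping.single [] 1 * f * Poly_Mapping.single k (Poly_Mapping.lookup h k))
      \<in> combos R (\<lambda>_. True)"
    by (intro combos_sum combos_mult[OF assms]) simp
  also have "(\<Sum>k\<in>Poly_Mapping.keys h. Poly_Mapping.single [] 1 * f * Poly_Mapping.single k (Poly_Mapping.lookup h k)) = f * h"
    by (simp add: sum_single_lookup flip: sum_distrib_left)
  finally show ?thesis .
qed

lemma ideal_combos:
  "ideal (combos R (\<lambda>_. True) \<inter> carrier (free_algebra X)) (free_algebra X :: 'a::comm_ring_1 ncpoly ring)"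
proof (rule idealI)
  interpret ring "free_algebra X :: 'a ncpoly ring" by (rule ring_free_algebra)
  show "ring (free_algebra X :: 'a ncpoly ring)" by (rule ring_free_algebra)
  show "subgroup (combos R (\<lambda>_. True) \<inter> carrier (free_algebra X)) (add_monoid (free_algebra X :: 'a ncpoly ring))"
  proof (rule add.subgroupI)
    show "combos R (\<lambda>_. True) \<inter> carrier (free_algebra X) \<noteq> {}"
      using combos.zero zero_closed unfolding free_algebra_simps(4) by blast
  next
    fix f :: "'a ncpoly" assume "f \<in> combos R (\<lambda>_. True) \<inter> carrier (free_algebra X)"
    then show "\<ominus>\<^bsub>free_algebra X\<^esub> f \<in> combos R (\<lambda>_. True) \<inter> carrier (free_algebra X)"
      using a_inv_closed[of f] by (simp add: a_inv_free_algebra combos_uminus)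
  next
    fix f h :: "'a ncpoly"
    assume "f \<in> combos R (\<lambda>_. True) \<inter> carrier (free_algebra X)" "h \<in> combos R (\<lambda>_. True) \<inter> carrier (free_algebra X)"
    then show "f \<oplus>\<^bsub>free_algebra X\<^esub> h \<in> combos R (\<lambda>_. True) \<inter> carrier (free_algebra X)"
      using a_closed[of f h] by (simp add: free_algebra_simps(3) combos_add)
  qed simp
next
  interpret ring "free_algebra X :: 'a ncpoly ring" by (rule ring_free_algebra)
  fix a x :: "'a ncpoly"
  assume "a \<in> combos R (\<lambda>_. True) \<inter> carrier (free_algebra X)" "x \<in> carrier (free_algebra X)"
  then show "x \<otimes>\<^bsub>free_algebra X\<^esub> a \<in> combos R (\<lambda>_. True) \<inter> carrier (free_algebra X)"
    "a \<otimes>\<^bsub>free_algebra X\<^esub> x \<in> combos R (\<lambda>_. True) \<inter> carrier (free_algebra X)"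
    using m_closed[of x a] m_closed[of a x]
    by (simp_all add: free_algebra_simps(2) combos_mult_poly_left combos_mult_poly_right)
qed

lemma G_in_carrier:
  assumes "i \<in> {1..n + 1}"
  shows "G n i \<in> carrier (free_algebra {1..n + 1} :: 'a::comm_ring_1 ncpoly ring)"
proof -
  have "k \<in> lists {1..n + 1}" if "k \<in> Poly_Mapping.keys (G n i :: 'a ncpoly)" for k
  proof -
    have "Poly_Mapping.lookup (full_skew ({1..n + 1} - {i}) :: 'a ncpoly) k \<noteq> 0
        \<or> Poly_Mapping.lookup (var 1 :: 'a ncpoly) k \<noteq> 0"
      using that assms by (auto simp: G_eq in_keys_iff lookup_sign_mult lookup_minus split: if_splits)
    then show ?thesis
    proof
      assume "Poly_Mapping.lookup (full_skew ({1..n + 1} - {i}) :: 'a ncpoly) k \<noteq> 0"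
      then have "k \<in> permutations_of_set ({1..n + 1} - {i})"
        unfolding lookup_skew by (simp split: if_splits)
      then show ?thesis by (auto simp: permutations_of_set_def)
    next
      assume "Poly_Mapping.lookup (var 1 :: 'a ncpoly) k \<noteq> 0"
      then have "k = [1]" by (simp add: var_def lookup_single when_def split: if_splits)
      then show ?thesis by simp
    qed
  qed
  then show ?thesis unfolding free_algebra_simps by blast
qed

text \<open>
  The syzygy is an element of the ideal equal to \<open>N\<close> up to sign, and \<open>H\<^sub>i\<close> differs from \<open>G\<^sub>i\<close> by multiples
  of \<open>N\<close>.
\<close>

lemma basis_in_ideal:
  fixes J :: "'a::comm_ring_1 ncpoly set"
  assumes J: "ideal J (free_algebra {1..n + 1})" and G: "\<And>i. i \<in> {1..n + 1} \<Longrightarrow> G n i \<in> J"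
    and "even n"
  shows "N n \<in> J" and "i \<in> {2..n} \<Longrightarrow> H n i \<in> J"
proof -
  let ?F = "free_algebra {1..n + 1} :: 'a ncpoly ring"
  interpret ideal J ?F by (rule J)
  have add: "f + h \<in> J" if "f \<in> J" "h \<in> J" for f h
    using additive_subgroup.a_closed[OF is_additive_subgroup that] by (simp only: free_algebra_simps(3))
  have zero: "0 \<in> J"
    using additive_subgroup.zero_closed[OF is_additive_subgroup] by (simp only: free_algebra_simps(4))
  have single: "Poly_Mapping.single u c \<in> carrier ?F" if "set u \<subseteq> {1..n + 1}" for u c
    using that by (simp add: free_algebra_simps in_lists_conv_set subset_eq)
  have left: "Poly_Mapping.single u c * f \<in> J" if "f \<in> J" "set u \<subseteq> {1..n + 1}" for u c f
    using I_l_closed[OF that(1) single[OF that(2)]] by (simp only: free_algebra_simps(2))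
  have uminus: "- f \<in> J" if "f \<in> J" for f
    using left[OF that, of "[]" "- 1"] by (simp add: single_uminus)
  have sign: "(-1) ^ m * f \<in> J" if "f \<in> J" for f m
    using that uminus by (cases "even m") simp_all
  have sum: "sum f I \<in> J" if "\<And>x. x \<in> I \<Longrightarrow> f x \<in> J" for f :: "'b \<Rightarrow> 'a ncpoly" and I
    using that by (induction I rule: infinite_finite_induct) (simp_all add: zero add)
  have right: "f * Poly_Mapping.single u c \<in> J" if "f \<in> J" "set u \<subseteq> {1..n + 1}" for u c f
    using I_r_closed[OF that(1) single[OF that(2)]] by (simp only: free_algebra_simps(2))
  have diff: "f - h \<in> J" if "f \<in> J" "h \<in> J" for f h
    using add[OF that(1) uminus[OF that(2)]] by simp
  have "(\<Sum>i\<in>{1..n + 1}. (-1) ^ (i - 1) * (var i * G n i - G n i * var i)) \<in> J"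
    unfolding var_def by (intro sum sign diff left right G) simp_all
  then have "(-1) ^ (n div 2) * (- ((-1) ^ (n div 2) * N n)) \<in> J"
    unfolding signed_commutator_sum[OF \<open>even n\<close>] by (rule sign)
  then have "- ((-1) ^ (n div 2) * (- ((-1) ^ (n div 2) * N n))) \<in> J"
    by (rule uminus)
  then show N: "N n \<in> J"
    by (cases "even (n div 2)") simp_all
  show "H n i \<in> J" if i: "i \<in> {2..n}"
  proof -
    let ?S = "\<Sum>(u, v) | u @ [n + 1, 1] @ v \<in> permutations_of_set ({1..n + 1} - {i}).
      Poly_Mapping.single u (of_int (word_sign (u @ [n + 1, 1] @ v))) * N n * Poly_Mapping.single v 1 :: 'a ncpoly"
    have "?S \<in> J"
    proof (rule sum)
      fix x assume "x \<in> {(u, v). u @ [n + 1, 1] @ v \<in> permutations_of_set ({1..n + 1} - {i})}"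
      then obtain u v where x: "x = (u, v)" and "set (u @ [n + 1, 1] @ v) = {1..n + 1} - {i}"
        unfolding permutations_of_set_def by blast
      then have "set u \<subseteq> {1..n + 1}" "set v \<subseteq> {1..n + 1}" by auto
      then show "(case x of (u, v) \<Rightarrow> Poly_Mapping.single u (of_int (word_sign (u @ [n + 1, 1] @ v))) * N n * Poly_Mapping.single v 1) \<in> J"
        unfolding x prod.case by (intro left right N)
    qed
    then have "G n i - (-1) ^ (n div 2) * ?S \<in> J"
      using i by (intro diff sign G) simp_all
    moreover have "H n i = G n i - (-1) ^ (n div 2) * ?S"
      using G_eq_H_plus_N_multiples[of i n, where 'a='a] i by simp
    ultimately show ?thesis by simp
  qed
qed

section \<open>The Groebner basis\<close>

theorem theorem5p4:
  fixes n :: nat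
    and scale :: "'a::field \<Rightarrow> 'v::ab_group_add \<Rightarrow> 'v"
    and L :: "'v set" and bracket :: "'v list \<Rightarrow> 'v" and e :: "nat \<Rightarrow> 'v"
  assumes "n \<ge> 4" and "even n"
    and "n_lie_algebra scale L n bracket"
    and "inj_on e {1..n + 1}"
    and "\<not> module.dependent scale (e ` {1..n + 1})"
    and "module.span scale (e ` {1..n + 1}) = L"
    and "bracket (map e [1..<n + 1]) = e 1"
    and "\<And>js. \<lbrakk>length js = n; set js \<subseteq> {1..n + 1}; set js \<noteq> {1..n}\<rbrakk> \<Longrightarrow> bracket (map e js) = 0"
  shows "is_groebner_basis
    ({G n 1} \<union> H n ` {2..n} \<union> {G n (n + 1), N n})
    (Idl\<^bsub>free_algebra {1..n + 1}\<^esub> (G n ` {1..n + 1}) :: 'a ncpoly set)"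
  unfolding is_groebner_basis_def
proof (intro conjI ballI impI)
  let ?F = "free_algebra {1..n + 1} :: 'a ncpoly ring"
  let ?B = "{G n 1} \<union> H n ` {2..n} \<union> {G n (n + 1), N n} :: 'a ncpoly set"
  let ?R = "rules n :: (nat list \<times> 'a ncpoly) set"
  let ?I = "Idl\<^bsub>?F\<^esub> (G n ` {1..n + 1})"
  interpret ring ?F by (rule ring_free_algebra)
  have carrier: "G n ` {1..n + 1} \<subseteq> carrier ?F"
    using G_in_carrier[of _ n] by blast
  have G: "G n i \<in> ?I" if "i \<in> {1..n + 1}" for i
    using genideal_self[OF carrier] that by blast
  show "?B \<subseteq> ?I"
    using G[of 1] G[of "n + 1"] basis_in_ideal[OF genideal_ideal[OF carrier] G \<open>even n\<close>] by auto
  have "G n i \<in> combos ?R (\<lambda>_. True)" if "i \<in> {1..n + 1}" for i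
  proof -
    have "i \<in> {2..n} \<or> i = 1 \<or> i = n + 1" using that by auto
    then consider "i \<in> {2..n}" | "i = 1" | "i = n + 1" by blast
    then show ?thesis
    proof cases
      case 1
      then show ?thesis using G_middle_combos[of i n "\<lambda>_. True" "[]" "[]", where 'a='a] by simp
    next
      case 2
      then show ?thesis
        using combos_term[of "lead n 1" "G n 1" ?R "\<lambda>_. True" "[]" "[]" 1 1] by (simp add: rules_def)
    next
      case 3
      then show ?thesis
        using combos_term[of "lead n (n + 1)" "G n (n + 1)" ?R "\<lambda>_. True" "[]" "[]" 1 1] by (simp add: rules_def)
    qed
  qed
  then have "?I \<subseteq> combos ?R (\<lambda>_. True) \<inter> carrier ?F"
    using carrier by (intro genideal_minimal ideal_combos) blast
  moreover fix f assume "f \<in> ?I" "f \<noteq> 0"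
  ultimately have f: "f \<in> combos ?R (\<lambda>_. True)" "f \<noteq> 0" by auto
  have "\<exists>(l, g)\<in>?R. sublist l (LM f)"
  proof (rule groebner_if_overlaps_resolve[OF _ _ f])
    show "monic_at g l" if "(l, g) \<in> ?R" for l g
      using rules_monic[OF \<open>n \<ge> 4\<close> that] .
  next
    fix l g l' g' u v v'
    assume r: "(l, g) \<in> ?R" "(l', g') \<in> ?R" "l @ v = u @ l' @ v'" "length u < length l"
    from rules_overlap_cases[OF \<open>n \<ge> 4\<close> r]
    show "g * Poly_Mapping.single v 1 - Poly_Mapping.single u 1 * g' * Poly_Mapping.single v' 1
      \<in> combos ?R (\<lambda>z. deglex_less z (l @ v))"
    proof (elim disjE conjE)
      assume "u = []" "g = g'" "v = v'"
      then show ?thesis by (simp add: combos.zero)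
    next
      assume *: "l = lead n 1" "g = G n 1" "g' = G n (n + 1)" "u = [n + 1]" "v = 1 # v'"
      have lv: "l @ v = rev [1..<n + 2] @ v'"
        using lead_first_append[of n] \<open>n \<ge> 4\<close> unfolding * by (simp flip: append_assoc)
      have "Poly_Mapping.single [] 1 * (G n 1 * var 1 - var (n + 1) * G n (n + 1)) * Poly_Mapping.single v' 1
          \<in> combos ?R (\<lambda>z. deglex_less z (l @ v))"
        by (rule combos_mult[OF overlap_resolves[OF assms(1,2)]])
           (use deglex_append[of _ "rev [1..<n + 2]" "[]" v'] in \<open>simp only: lv append_Nil\<close>)
      also have "Poly_Mapping.single [] 1 * (G n 1 * var 1 - var (n + 1) * G n (n + 1)) * Poly_Mapping.single v' 1
          = g * Poly_Mapping.single v 1 - Poly_Mapping.single u 1 * g' * Poly_Mapping.single v' 1"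
        by (simp add: * var_def left_diff_distrib mult.assoc single_mult_single)
      finally show ?thesis .
    qed
  qed
  then obtain l g where lg: "(l, g) \<in> ?R" "sublist l (LM f)" by blast
  have "g \<in> ?B" using lg(1) unfolding rules_def by auto
  moreover have "g \<noteq> 0" "LM g = l"
    using rules_monic[OF \<open>n \<ge> 4\<close> lg(1)] by (simp_all add: monic_at_nonzero LM_monic_at)
  ultimately show "\<exists>g\<in>?B. g \<noteq> 0 \<and> sublist (LM g) (LM f)"
    using lg(2) by blast
qed

end
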